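(* Let $\delta>0$, let $(X,d,\mu)$ be an Ahlfors $\delta$-regular metric-measure space and let $\Delta$ be its logarithmic Dirichlet Laplacian on $L^2(X,\mu)$. Then there is a continuous inclusion $\operatorname{Din}(X,d)\hookrightarrow\operatorname{Dom}\Delta$, where $\operatorname{Din}(X,d)$ is the space of Dini continuous functions with the Dini norm and $\operatorname{Dom}\Delta$ carries the graph norm of $\Delta$.
   Context: A metric-measure space is a triple $(X,d,\mu)$ where $(X,d)$ is a locally compact second-countable metric space and $\mu$ is a finite Borel measure on $X$. It is Ahlfors $\delta$-regular ($\delta>0$) if there is $C\ge 1$ such that $C^{-1}r^\delta\le\mu(\overline B(x,r))\le Cr^\delta$ for all $x\in X$ and $0\le r<\operatorname{diam}X$; then $\operatorname{diam} X<\infty$. $L^2(X,\mu)$ denotes the real Hilbert space of real-valued square-integrable functions. Define $$\operatorname{Dom}\mathcal E=\Big\{f\in L^2(X,\mu):\int_X\int_X\frac{|f(x)-f(y)|^2}{d(x,y)^\delta}\,d\mu(y)\,d\mu(x)<\infty\Big\},$$ $$\mathcal E(f,g)=\frac12\int_X\int_X\frac{(f(x)-f(y))(g(x)-g(y))}{d(x,y)^\delta}\,d\mu(y)\,d\mu(x),\qquad f,g\in\operatorname{Dom}\mathcal E,$$ the integrals being over the complement of the diagonal in $X\times X$. This is a densely defined closed form. The logarithmic Dirichlet Laplacian $\Delta$ is the positive self-adjoint operator associated with $\mathcal E$: if $R:L^2(X,\mu)\to\operatorname{Dom}\mathcal E$ is determined by $\langle Rf,g\rangle_{L^2}+\mathcal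 E(Rf,g)=\langle f,g\rangle_{L^2}$ for all $g\in\operatorname{Dom}\mathcal E$, then $\operatorname{Dom}\Delta=R(L^2(X,\mu))$ and $\Delta Rf=f-Rf$. Thus $R=(1+\Delta)^{-1}$, $\operatorname{Dom}\mathcal E=\operatorname{Dom}\Delta^{1/2}$ and $\mathcal E(f,g)=\langle\Delta^{1/2}f,\Delta^{1/2}g\rangle_{L^2}$. The graph norm of $\Delta$ is (equivalent to) $\|f\|_{L^2}+\|\Delta f\|_{L^2}$. A bounded uniformly continuous function $h:X\to\mathbb R$ is Dini continuous if $\operatorname{Din}(h):=\int_0^1\frac{\omega_h(t)}{t}\,dt<\infty$, where $\omega_h(t)=\sup\{|h(x)-h(y)|:d(x,y)\le t\operatorname{diam}(X)\}$ for $t\in[0,1]$. $\operatorname{Din}(X,d)$ is the set of Dini continuous functions, with Dini norm $\|h\|_{\operatorname{Din}}=\|h\|_\infty+\operatorname{Din}(h)$. *)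

theory Defs
  imports "HOL-Analysis.Analysis"
begin

text \<open>
  The space X is the whole type; a measure on it is a Borel measure when its sigma-algebra is
  that of \<^const>\<open>borel\<close>.
\<close>

definition metric_measure_space ::
    "'a::{metric_space,second_countable_topology} measure \<Rightarrow> bool" where
  "metric_measure_space M \<longleftrightarrow>
     locally_compact_space (euclidean :: 'a topology) \<and> sets M = sets borel \<and> finite_measure M"

text \<open>
  The library's \<^const>\<open>diameter\<close> has no meaningful value on unbounded sets, so the side condition
  on radii uses an extended real diameter.
\<close>

definition ediam :: "'a::metric_space itself \<Rightarrow> ereal" where
  "ediam _ = (SUP (x::'a, y) \<in> UNIV. ereal (dist x y))"

lemma ediam_eq_diameter:
  assumes "bounded (UNIV :: 'a::metric_space set)"
  shows "ediam TYPE('a) = ereal (diameter (UNIV :: 'a set))"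
  unfolding ediam_def
proof (rule antisym)
  show "(SUP (x::'a, y) \<in> UNIV. ereal (dist x y)) \<le> ereal (diameter (UNIV :: 'a set))"
    using diameter_bounded_bound[OF assms] by (auto intro!: SUP_least)
  have le: "ereal (dist x y) \<le> (SUP (x::'a, y) \<in> UNIV. ereal (dist x y))" for x y :: 'a
    by (rule SUP_upper2[of "(x, y)"]) auto
  show "ereal (diameter (UNIV :: 'a set)) \<le> (SUP (x::'a, y) \<in> UNIV. ereal (dist x y))"
    (is "_ \<le> ?S")
  proof (cases ?S)
    case (real s)
    then have "dist x y \<le> s" for x y :: 'a
      using le[of x y] by simp
    then show ?thesis
      unfolding real diameter_def by (auto intro!: cSUP_least)
  next
    case MInf
    then show ?thesis using le[of undefined undefined] by simp
  qed simp
qed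

definition ahlfors_regular :: "'a::metric_space measure \<Rightarrow> real \<Rightarrow> bool" where
  "ahlfors_regular M \<delta> \<longleftrightarrow>
     (\<exists>C\<ge>1. \<forall>x r. 0 \<le> r \<and> ereal r < ediam TYPE('a) \<longrightarrow>
        inverse C * r powr \<delta> \<le> measure M (cball x r) \<and>
        measure M (cball x r) \<le> C * r powr \<delta>)"

text \<open>
  The elements of the real Hilbert space \<open>L2 M\<close> are the classes, modulo almost everywhere equality,
  of square-integrable functions.  Operations on classes are computed on the chosen representatives
  \<open>l2_rep\<close>; none of them depends on that choice.
\<close>

definition square_integrable :: "'a measure \<Rightarrow> ('a \<Rightarrow> real) set" where
  "square_integrable M = {f \<in> borel_measurable M. integrable M (\<lambda>x. (f x)\<^sup>2)}"

definition l2_class :: "'a measure \<Rightarrow> ('a \<Rightarrow> real) \<Rightarrow> ('a \<Rightarrow> real) set" where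
  "l2_class M f = {g \<in> square_integrable M. AE x in M. g x = f x}"

definition L2 :: "'a measure \<Rightarrow> ('a \<Rightarrow> real) set set" where
  "L2 M = l2_class M ` square_integrable M"

definition l2_rep :: "('a \<Rightarrow> real) set \<Rightarrow> 'a \<Rightarrow> real" where
  "l2_rep F = (SOME f. f \<in> F)"

definition l2_inner :: "'a measure \<Rightarrow> ('a \<Rightarrow> real) set \<Rightarrow> ('a \<Rightarrow> real) set \<Rightarrow> real" where
  "l2_inner M F G = (LINT x|M. l2_rep F x * l2_rep G x)"

definition l2_norm :: "'a measure \<Rightarrow> ('a \<Rightarrow> real) set \<Rightarrow> real" where
  "l2_norm M F = sqrt (l2_inner M F F)"

definition l2_diff ::
    "'a measure \<Rightarrow> ('a \<Rightarrow> real) set \<Rightarrow> ('a \<Rightarrow> real) set \<Rightarrow> ('a \<Rightarrow> real) set" where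
  "l2_diff M F G = l2_class M (\<lambda>x. l2_rep F x - l2_rep G x)"

definition form_dom :: "'a::metric_space measure \<Rightarrow> real \<Rightarrow> ('a \<Rightarrow> real) set set" where
  "form_dom M \<delta> = {F \<in> L2 M.
     (\<integral>\<^sup>+x. (\<integral>\<^sup>+y\<in>-{x}. ennreal (\<bar>l2_rep F x - l2_rep F y\<bar>\<^sup>2 / dist x y powr \<delta>) \<partial>M) \<partial>M) < \<infinity>}"

definition log_form ::
    "'a::metric_space measure \<Rightarrow> real \<Rightarrow> ('a \<Rightarrow> real) set \<Rightarrow> ('a \<Rightarrow> real) set \<Rightarrow> real" where
  "log_form M \<delta> F G = 1/2 *
     (LINT x|M. (LINT y:-{x}|M.
        (l2_rep F x - l2_rep F y) * (l2_rep G x - l2_rep G y) / dist x y powr \<delta>))"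

definition log_resolvent ::
    "'a::metric_space measure \<Rightarrow> real \<Rightarrow> ('a \<Rightarrow> real) set \<Rightarrow> ('a \<Rightarrow> real) set" where
  "log_resolvent M \<delta> F = (THE U. U \<in> form_dom M \<delta> \<and>
     (\<forall>G\<in>form_dom M \<delta>. l2_inner M U G + log_form M \<delta> U G = l2_inner M F G))"

definition dom_log_laplacian :: "'a::metric_space measure \<Rightarrow> real \<Rightarrow> ('a \<Rightarrow> real) set set" where
  "dom_log_laplacian M \<delta> = log_resolvent M \<delta> ` L2 M"

text \<open>
  On its domain the operator is given by \<open>R F \<mapsto> F - R F\<close>, where \<open>R\<close> is the resolvent; the
  description is unique because \<open>R\<close> is injective, the form being densely defined.
\<close>

definition log_laplacian ::
    "'a::metric_space measure \<Rightarrow> real \<Rightarrow> ('a \<Rightarrow> real) set \<Rightarrow> ('a \<Rightarrow> real) set" where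
  "log_laplacian M \<delta> U =
     (THE V. \<exists>F\<in>L2 M. U = log_resolvent M \<delta> F \<and> V = l2_diff M F (log_resolvent M \<delta> F))"

definition graph_norm :: "'a::metric_space measure \<Rightarrow> real \<Rightarrow> ('a \<Rightarrow> real) set \<Rightarrow> real" where
  "graph_norm M \<delta> U = l2_norm M U + l2_norm M (log_laplacian M \<delta> U)"

text \<open>
  The suprema below are taken in the reals, which is meaningful for bounded functions.  An Ahlfors
  regular space of finite measure is bounded, so that \<^const>\<open>diameter\<close> is meaningful too.
\<close>

definition modulus :: "('a::metric_space \<Rightarrow> real) \<Rightarrow> real \<Rightarrow> real" where
  "modulus h t = Sup {\<bar>h x - h y\<bar> | x y. dist x y \<le> t * diameter (UNIV :: 'a set)}"

definition dini_integral :: "('a::metric_space \<Rightarrow> real) \<Rightarrow> ennreal" where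
  "dini_integral h = (\<integral>\<^sup>+t\<in>{0<..1}. ennreal (modulus h t / t) \<partial>lborel)"

definition dini_space :: "('a::metric_space \<Rightarrow> real) set" where
  "dini_space = {h. bounded (range h) \<and> uniformly_continuous_on UNIV h \<and> dini_integral h < \<infinity>}"

definition dini_norm :: "('a::metric_space \<Rightarrow> real) \<Rightarrow> real" where
  "dini_norm h = (SUP x. \<bar>h x\<bar>) + enn2real (dini_integral h)"

end

theory Submission
  imports Defs
begin

text \<open>
  A Dini function \<open>h\<close> lies in the domain of the Laplacian because the singular integral
  \<open>\<integral> (h x - h y) / dist x y powr \<delta>\<close> over \<open>y\<close> converges absolutely, with a bound by a constant times
  the Dini norm that does not depend on \<open>x\<close>. This is \<open>dini_kernel_bound\<close>: at scale \<open>r = t * D\<close>,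
  where \<open>D\<close> is the diameter, the numerator is at most the modulus of continuity at \<open>t\<close>, and the
  factor \<open>r powr (- \<delta>)\<close> is cancelled by the measure of a ball of radius \<open>r\<close>; adding up the scales
  against \<open>dt / t\<close> gives the Dini integral. Hence the pointwise Laplacian of \<open>h\<close> is a bounded
  function, and by Fubini it satisfies Green's formula \<open>energy_inner_dini\<close> against every \<open>g\<close> of
  finite energy. In other words \<open>h\<close> is the resolvent of \<open>h\<close> plus its pointwise Laplacian, so that
  \<open>h\<close> is in the domain, the operator acts on it pointwise, and the graph norm is at most the
  square root of the total mass times the sum of the two uniform bounds.

  Two facts about the form make this conclusion legitimate, since the resolvent and the operator
  are given by definite descriptions. Every square-integrable function has a weak solution
  (\<open>weak_solution_exists\<close>), by the Riesz representation theorem and the closedness of the form; and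
  the resolvent is injective, because the form is densely defined (\<open>energy_space_separating\<close>). The
  density again rests on the kernel bound, as bounded Lipschitz functions are Dini continuous.
\<close>

section \<open>Representing functionals on a complete form\<close>

lemma nonneg_quadratic_imp_discriminant:
  fixes a b d :: real
  assumes nonneg: "\<And>c. 0 \<le> a + 2 * c * b + c\<^sup>2 * d" and "0 \<le> d"
  shows "b\<^sup>2 \<le> a * d"
proof (cases "d = 0")
  case True
  have "b = 0"
  proof (rule ccontr)
    assume "b \<noteq> 0"
    then have "a + 2 * (-(a + 1) / (2 * b)) * b = -1" by (simp add: field_simps)
    then show False using nonneg[of "-(a + 1) / (2 * b)"] True by simp
  qed
  then show ?thesis using True by simp
next
  case False
  then have "d > 0" using \<open>0 \<le> d\<close> by simp
  have "0 \<le> (a + 2 * (- b / d) * b + (- b / d)\<^sup>2 * d) * d"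
    using nonneg[of "- b / d"] \<open>d > 0\<close> by (intro mult_nonneg_nonneg) auto
  also have "\<dots> = a * d - b\<^sup>2"
    using \<open>d > 0\<close> by (simp add: field_simps power2_eq_square)
  finally show ?thesis by simp
qed

text \<open>
  The Riesz representation theorem for a positive semidefinite form, proved by the direct method: a
  minimizer of \<open>J f = B f f - 2 * L f\<close> satisfies \<open>B f g = L g\<close> for all \<open>g\<close>, because
  \<open>c \<mapsto> J (f + c * g)\<close> has its minimum at \<open>0\<close>. Completeness is only demanded of sequences with
  geometrically decreasing increments; a minimizing sequence can be chosen that fast, and in
  function spaces such sequences converge almost everywhere without passing to subsequences.
\<close>

lemma riesz_by_minimization:
  fixes V :: "('b \<Rightarrow> real) set" and B :: "('b \<Rightarrow> real) \<Rightarrow> ('b \<Rightarrow> real) \<Rightarrow> real"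
    and L :: "('b \<Rightarrow> real) \<Rightarrow> real"
  assumes "V \<noteq> {}"
    and lin: "\<And>f g c. f \<in> V \<Longrightarrow> g \<in> V \<Longrightarrow> (\<lambda>x. f x + c * g x) \<in> V"
    and B_lin: "\<And>f g k c. f \<in> V \<Longrightarrow> g \<in> V \<Longrightarrow> k \<in> V \<Longrightarrow>
      B (\<lambda>x. f x + c * g x) k = B f k + c * B g k"
    and B_sym: "\<And>f g. B f g = B g f"
    and B_pos: "\<And>f. f \<in> V \<Longrightarrow> 0 \<le> B f f"
    and complete: "\<And>u. (\<And>n. u n \<in> V) \<Longrightarrow>
      (\<And>m n. n \<le> m \<Longrightarrow> B (\<lambda>x. u m x - u n x) (\<lambda>x. u m x - u n x) \<le> (1/4) ^ n) \<Longrightarrow>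
      \<exists>f\<in>V. (\<lambda>n. B (\<lambda>x. u n x - f x) (\<lambda>x. u n x - f x)) \<longlonglongrightarrow> 0"
    and L_lin: "\<And>f g c. f \<in> V \<Longrightarrow> g \<in> V \<Longrightarrow> L (\<lambda>x. f x + c * g x) = L f + c * L g"
    and L_bound: "\<And>f. f \<in> V \<Longrightarrow> (L f)\<^sup>2 \<le> K * B f f" and "0 \<le> K"
  shows "\<exists>f\<in>V. \<forall>g\<in>V. B f g = L g"
proof -
  have diff: "(\<lambda>x. f x - g x) \<in> V" if "f \<in> V" "g \<in> V" for f g
    using lin[OF that, of "-1"] by simp
  have B_lin2: "B k (\<lambda>x. f x + c * g x) = B k f + c * B k g"
    if "f \<in> V" "g \<in> V" "k \<in> V" for f g k c
    using B_lin[OF that] B_sym by metis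
  have B_diff: "B (\<lambda>x. f x - g x) k = B f k - B g k" if "f \<in> V" "g \<in> V" "k \<in> V" for f g k
    using B_lin[OF that, of "-1"] by simp
  have B_expand: "B (\<lambda>x. f x + c * g x) (\<lambda>x. f x + c * g x) = B f f + 2 * c * B f g + c\<^sup>2 * B g g"
    if "f \<in> V" "g \<in> V" for f g c
    using that lin[OF that, of c] B_sym[of g f]
    by (simp add: B_lin B_lin2 algebra_simps power2_eq_square)
  have cauchy_schwarz: "(B f g)\<^sup>2 \<le> B f f * B g g" if "f \<in> V" "g \<in> V" for f g
  proof (rule nonneg_quadratic_imp_discriminant)
    show "0 \<le> B f f + 2 * c * B f g + c\<^sup>2 * B g g" for c
      using B_pos[OF lin[OF that, of c]] unfolding B_expand[OF that] .
    show "0 \<le> B g g" by (rule B_pos[OF that(2)])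
  qed
  define J where "J f = B f f - 2 * L f" for f
  have J_lower: "- K \<le> J f" if "f \<in> V" for f
  proof -
    have "(2 * L f)\<^sup>2 \<le> 4 * (K * B f f)"
      using L_bound[OF that] by (simp add: power2_eq_square)
    also have "\<dots> \<le> (B f f + K)\<^sup>2"
      using zero_le_power2[of "B f f - K"] by (simp add: power2_eq_square algebra_simps)
    finally have "2 * L f \<le> B f f + K"
      by (rule power2_le_imp_le) (use B_pos[OF that] \<open>0 \<le> K\<close> in simp)
    then show ?thesis by (simp add: J_def)
  qed
  define m where "m = Inf (J ` V)"
  have bdd: "bdd_below (J ` V)" using J_lower by (auto intro!: bdd_belowI[of _ "- K"])
  have m_le: "m \<le> J f" if "f \<in> V" for f
    unfolding m_def using bdd that by (auto intro: cINF_lower)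
  have "\<exists>f\<in>V. J f < m + (1/4) ^ n / 4" for n :: nat
    using cINF_less_iff[OF \<open>V \<noteq> {}\<close> bdd, of "m + (1/4) ^ n / 4"] by (simp add: m_def)
  then obtain u where u: "\<And>n. u n \<in> V" "\<And>n::nat. J (u n) < m + (1/4) ^ n / 4"
    by metis
  have J_expand: "J (\<lambda>x. f x + c * g x) = J f + 2 * c * (B f g - L g) + c\<^sup>2 * B g g"
    if "f \<in> V" "g \<in> V" for f g c
    using that by (simp add: J_def B_expand L_lin algebra_simps)
  have "B (\<lambda>x. u i x - u n x) (\<lambda>x. u i x - u n x) \<le> (1/4) ^ n" if "n \<le> i" for i n
  proof -
    \<comment> \<open>The parallelogram law: \<open>J\<close> is at least \<open>m\<close> at the midpoint of \<open>u n\<close> and \<open>u i\<close> and nearly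
      \<open>m\<close> at both ends, so the ends are close to each other.\<close>
    define w where "w = (\<lambda>x. u i x - u n x)"
    have w: "w \<in> V" unfolding w_def by (rule diff) (rule u)+
    have "u i = (\<lambda>x. u n x + 1 * w x)" by (auto simp: w_def)
    then have Ji: "J (u i) = J (u n) + 2 * (B (u n) w - L w) + B w w"
      using J_expand[OF u(1) w, of n 1] by simp
    have "m \<le> J (\<lambda>x. u n x + 1/2 * w x)" by (intro m_le lin u w)
    also have "\<dots> = J (u n) + (B (u n) w - L w) + B w w / 4"
      using J_expand[OF u(1) w, of n "1/2"] by (simp add: power2_eq_square)
    finally have "B w w \<le> 2 * (J (u i) - m) + 2 * (J (u n) - m)"
      using Ji by (simp add: algebra_simps)
    also have "\<dots> \<le> (1/4) ^ i / 2 + (1/4) ^ n / 2"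
      using u(2)[of i] u(2)[of n] by simp
    also have "\<dots> \<le> (1/4) ^ n"
    proof -
      have "(1/4::real) ^ i \<le> (1/4) ^ n" by (rule power_decreasing[OF that]) auto
      then show ?thesis by linarith
    qed
    finally show ?thesis by (simp add: w_def)
  qed
  then obtain f where f: "f \<in> V" "(\<lambda>n. B (\<lambda>x. u n x - f x) (\<lambda>x. u n x - f x)) \<longlonglongrightarrow> 0"
    using complete[of u] u(1) by blast
  have "B f g = L g" if g: "g \<in> V" for g
  proof -
    have "(\<lambda>n. (B (\<lambda>x. u n x - f x) g)\<^sup>2) \<longlonglongrightarrow> 0"
    proof (rule tendsto_sandwich[where f = "\<lambda>_. 0"])
      show "(\<lambda>n. B (\<lambda>x. u n x - f x) (\<lambda>x. u n x - f x) * B g g) \<longlonglongrightarrow> 0"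
        using tendsto_mult_right[OF f(2), of "B g g"] by simp
    qed (use cauchy_schwarz[OF diff[OF u(1) f(1)] g] in auto)
    then have "(\<lambda>n. B (\<lambda>x. u n x - f x) g) \<longlonglongrightarrow> 0"
      using tendsto_real_sqrt[of _ 0 sequentially] by (force simp: tendsto_rabs_zero_iff)
    then have "(\<lambda>n. B (u n) g - B f g) \<longlonglongrightarrow> 0"
      using B_diff[OF u(1) f(1) g] by simp
    then have lim: "(\<lambda>n. B (u n) g) \<longlonglongrightarrow> B f g"
      by (simp add: LIM_zero_iff)
    have "(B f g - L g)\<^sup>2 \<le> 0 * B g g"
    proof (rule nonneg_quadratic_imp_discriminant)
      fix c :: real
      \<comment> \<open>The minimality of \<open>m\<close> along the line through \<open>u n\<close> in direction \<open>g\<close>; it passes to the limit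
        because \<open>B (u n) g\<close> converges, so that continuity of \<open>J\<close> itself is avoided.\<close>
      have low: "- ((1/4) ^ n / 4) \<le> 0 + 2 * c * (B (u n) g - L g) + c\<^sup>2 * B g g" for n
        using m_le[OF lin[OF u(1) g], of n c] u(2)[of n] J_expand[OF u(1) g, of n c] by simp
      have "(\<lambda>n. - ((1/4) ^ n / 4) :: real) \<longlonglongrightarrow> - (0 / 4)"
        by (intro tendsto_intros LIMSEQ_realpow_zero) auto
      then have "(\<lambda>n. - ((1/4) ^ n / 4) :: real) \<longlonglongrightarrow> 0" by simp
      moreover have "(\<lambda>n. 0 + 2 * c * (B (u n) g - L g) + c\<^sup>2 * B g g)
          \<longlonglongrightarrow> 0 + 2 * c * (B f g - L g) + c\<^sup>2 * B g g"
        by (intro tendsto_intros lim)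
      ultimately show "0 \<le> 0 + 2 * c * (B f g - L g) + c\<^sup>2 * B g g"
        by (rule LIMSEQ_le) (use low in auto)
    qed (use B_pos g in simp)
    then show ?thesis by simp
  qed
  then show ?thesis using f(1) by blast
qed

section \<open>Square-integrable functions and their classes\<close>

lemma square_integrable_mult:
  assumes "f \<in> square_integrable N" "g \<in> square_integrable N"
  shows "integrable N (\<lambda>x. f x * g x)"
proof (rule Bochner_Integration.integrable_bound)
  show "integrable N (\<lambda>x. (f x)\<^sup>2 + (g x)\<^sup>2)"
    using assms by (auto simp: square_integrable_def)
  have "\<bar>a * b\<bar> \<le> a\<^sup>2 + b\<^sup>2" for a b :: real
  proof -
    have "2 * \<bar>a\<bar> * \<bar>b\<bar> \<le> a\<^sup>2 + b\<^sup>2"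
      using sum_squares_bound[of "\<bar>a\<bar>" "\<bar>b\<bar>"] by simp
    moreover have "0 \<le> \<bar>a\<bar> * \<bar>b\<bar>" by simp
    ultimately show ?thesis unfolding abs_mult by linarith
  qed
  then show "AE x in N. norm (f x * g x) \<le> norm ((f x)\<^sup>2 + (g x)\<^sup>2)" by simp
qed (use assms in \<open>auto simp: square_integrable_def\<close>)

lemma square_integrable_lincomb:
  assumes f: "f \<in> square_integrable N" and g: "g \<in> square_integrable N"
  shows "(\<lambda>x. f x + c * g x) \<in> square_integrable N"
proof -
  have "(\<lambda>x. (f x + c * g x)\<^sup>2) = (\<lambda>x. (f x)\<^sup>2 + 2 * c * (f x * g x) + c\<^sup>2 * (g x)\<^sup>2)"
    by (auto simp: power2_eq_square algebra_simps)
  then show ?thesis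
    using square_integrable_mult[OF f g] f g by (auto simp: square_integrable_def)
qed

lemma square_integrable_diff:
  assumes "f \<in> square_integrable N" "g \<in> square_integrable N"
  shows "(\<lambda>x. f x - g x) \<in> square_integrable N"
  using square_integrable_lincomb[OF assms, of "-1"] by simp

lemma square_integrable_cong_AE:
  assumes "f \<in> square_integrable N" "g \<in> borel_measurable N" "AE x in N. g x = f x"
  shows "g \<in> square_integrable N"
proof -
  have "AE x in N. (g x)\<^sup>2 = (f x)\<^sup>2" using assms(3) by eventually_elim simp
  then show ?thesis
    using assms integrable_cong_AE[of "\<lambda>x. (g x)\<^sup>2" N "\<lambda>x. (f x)\<^sup>2"]
      borel_measurable_power[of f N 2] borel_measurable_power[of g N 2]
    unfolding square_integrable_def by blast
qed

lemma square_integrable_cauchy_schwarz: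
  assumes f: "f \<in> square_integrable N" and g: "g \<in> square_integrable N"
  shows "(LINT x|N. f x * g x)\<^sup>2 \<le> (LINT x|N. (f x)\<^sup>2) * (LINT x|N. (g x)\<^sup>2)"
proof (rule nonneg_quadratic_imp_discriminant)
  fix c :: real
  have "0 \<le> (LINT x|N. (f x + c * g x)\<^sup>2)" by simp
  also have "\<dots> = (LINT x|N. (f x)\<^sup>2 + 2 * c * (f x * g x) + c\<^sup>2 * (g x)\<^sup>2)"
    by (intro Bochner_Integration.integral_cong) (auto simp: power2_eq_square algebra_simps)
  also have "\<dots> = (LINT x|N. (f x)\<^sup>2) + 2 * c * (LINT x|N. f x * g x) + c\<^sup>2 * (LINT x|N. (g x)\<^sup>2)"
    using square_integrable_mult[OF f g] f g
    by (simp add: square_integrable_def)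
  finally show "0 \<le> (LINT x|N. (f x)\<^sup>2) + 2 * c * (LINT x|N. f x * g x) + c\<^sup>2 * (LINT x|N. (g x)\<^sup>2)" .
qed simp

text \<open>
  Lower semicontinuity of the square integral under almost everywhere convergence. Both halves of
  the energy are square integrals, one over the space and one over its square, so this lemma yields
  the closedness of the form for both at once.
\<close>

lemma square_integrable_fatou:
  assumes u: "\<And>n. u n \<in> square_integrable N" and v: "v \<in> borel_measurable N"
    and lim: "AE x in N. (\<lambda>n. u n x) \<longlonglongrightarrow> v x"
    and le: "\<And>n. n \<ge> k \<Longrightarrow> (LINT x|N. (u n x)\<^sup>2) \<le> c"
  shows "v \<in> square_integrable N \<and> (LINT x|N. (v x)\<^sup>2) \<le> c"
proof -
  have c: "0 \<le> c" using order_trans[OF _ le[of k]] by simp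
  have [measurable]: "u n \<in> borel_measurable N" "v \<in> borel_measurable N" for n
    using u v by (auto simp: square_integrable_def)
  have "(\<integral>\<^sup>+x. ennreal ((v x)\<^sup>2) \<partial>N) = (\<integral>\<^sup>+x. liminf (\<lambda>n. ennreal ((u n x)\<^sup>2)) \<partial>N)"
  proof (rule nn_integral_cong_AE)
    show "AE x in N. ennreal ((v x)\<^sup>2) = liminf (\<lambda>n. ennreal ((u n x)\<^sup>2))"
      using lim
    proof eventually_elim
      case (elim x)
      then have "(\<lambda>n. ennreal ((u n x)\<^sup>2)) \<longlonglongrightarrow> ennreal ((v x)\<^sup>2)"
        by (intro tendsto_intros)
      then show ?case by (intro lim_imp_Liminf[symmetric]) auto
    qed
  qed
  also have "\<dots> \<le> liminf (\<lambda>n. \<integral>\<^sup>+x. ennreal ((u n x)\<^sup>2) \<partial>N)"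
    by (rule nn_integral_liminf) simp
  also have "\<dots> \<le> liminf (\<lambda>n. ennreal c)"
  proof (rule Liminf_mono)
    have "(\<integral>\<^sup>+x. ennreal ((u n x)\<^sup>2) \<partial>N) \<le> ennreal c" if "n \<ge> k" for n
      using nn_integral_eq_integral[of N "\<lambda>x. (u n x)\<^sup>2"] u[of n] le[OF that]
      by (simp add: square_integrable_def ennreal_leI)
    then show "\<forall>\<^sub>F n in sequentially. (\<integral>\<^sup>+x. ennreal ((u n x)\<^sup>2) \<partial>N) \<le> ennreal c"
      by (auto simp: eventually_sequentially)
  qed
  also have "\<dots> = ennreal c" by (simp add: Liminf_const)
  finally have le_c: "(\<integral>\<^sup>+x. ennreal ((v x)\<^sup>2) \<partial>N) \<le> ennreal c" .
  then have "integrable N (\<lambda>x. (v x)\<^sup>2)"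
    by (intro integrableI_bounded) (auto simp: order_le_less_trans)
  moreover from this have "(LINT x|N. (v x)\<^sup>2) \<le> c"
    using le_c c nn_integral_eq_integral[of N "\<lambda>x. (v x)\<^sup>2"] by simp
  ultimately show ?thesis using v by (simp add: square_integrable_def)
qed

lemma l2_class_eq_iff:
  assumes "f \<in> square_integrable N" "g \<in> square_integrable N"
  shows "l2_class N f = l2_class N g \<longleftrightarrow> (AE x in N. f x = g x)"
proof
  assume "l2_class N f = l2_class N g"
  moreover have "f \<in> l2_class N f" using assms by (simp add: l2_class_def)
  ultimately show "AE x in N. f x = g x" by (auto simp: l2_class_def)
next
  assume "AE x in N. f x = g x"
  then have "(AE x in N. k x = f x) \<longleftrightarrow> (AE x in N. k x = g x)" for k
    by (auto elim!: AE_mp)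
  then show "l2_class N f = l2_class N g" by (auto simp: l2_class_def)
qed

lemma l2_class_in_L2: "f \<in> square_integrable N \<Longrightarrow> l2_class N f \<in> L2 N"
  by (simp add: L2_def)

lemma l2_rep_l2_class:
  assumes "f \<in> square_integrable N"
  shows "l2_rep (l2_class N f) \<in> square_integrable N" "AE x in N. l2_rep (l2_class N f) x = f x"
proof -
  have "f \<in> l2_class N f" using assms by (simp add: l2_class_def)
  then have "l2_rep (l2_class N f) \<in> l2_class N f" unfolding l2_rep_def by (rule someI[of "\<lambda>g. g \<in> l2_class N f"])
  then show "l2_rep (l2_class N f) \<in> square_integrable N" "AE x in N. l2_rep (l2_class N f) x = f x"
    by (auto simp: l2_class_def)
qed

lemma l2_class_l2_rep:
  assumes "F \<in> L2 N"
  shows "l2_rep F \<in> square_integrable N" "l2_class N (l2_rep F) = F"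
proof -
  obtain f where f: "f \<in> square_integrable N" "F = l2_class N f" using assms by (auto simp: L2_def)
  then show "l2_rep F \<in> square_integrable N" "l2_class N (l2_rep F) = F"
    using l2_rep_l2_class[OF f(1)] l2_class_eq_iff[of "l2_rep F" N f] by auto
qed

lemma l2_inner_l2_class:
  assumes f: "f \<in> square_integrable N" and g: "g \<in> square_integrable N"
  shows "l2_inner N (l2_class N f) (l2_class N g) = (LINT x|N. f x * g x)"
  unfolding l2_inner_def
proof (rule integral_cong_AE)
  show "AE x in N. l2_rep (l2_class N f) x * l2_rep (l2_class N g) x = f x * g x"
    using l2_rep_l2_class(2)[OF f] l2_rep_l2_class(2)[OF g] by eventually_elim simp
qed (use f g l2_rep_l2_class(1)[OF f] l2_rep_l2_class(1)[OF g] in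
      \<open>auto simp: square_integrable_def\<close>)

lemma l2_diff_l2_class:
  assumes f: "f \<in> square_integrable N" and g: "g \<in> square_integrable N"
  shows "l2_diff N (l2_class N f) (l2_class N g) = l2_class N (\<lambda>x. f x - g x)"
proof -
  have "AE x in N. l2_rep (l2_class N f) x - l2_rep (l2_class N g) x = f x - g x"
    using l2_rep_l2_class(2)[OF f] l2_rep_l2_class(2)[OF g] by eventually_elim simp
  then show ?thesis
    unfolding l2_diff_def
    using l2_class_eq_iff square_integrable_diff f g l2_rep_l2_class(1) by blast
qed

lemma l2_norm_l2_class_le:
  assumes fin: "finite_measure N" and f: "f \<in> square_integrable N"
    and "0 \<le> b" and le: "\<And>x. \<bar>f x\<bar> \<le> b"
  shows "l2_norm N (l2_class N f) \<le> sqrt (measure N (space N)) * b"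
proof -
  interpret finite_measure N by (rule fin)
  have "(LINT x|N. f x * f x) \<le> (LINT x|N. b\<^sup>2)"
  proof (rule integral_mono)
    show "integrable N (\<lambda>x. f x * f x)" by (rule square_integrable_mult[OF f f])
    show "f x * f x \<le> b\<^sup>2" for x
      using abs_le_square_iff[of "f x" b] le[of x] \<open>0 \<le> b\<close> by (simp add: power2_eq_square)
  qed simp
  also have "\<dots> = measure N (space N) * b\<^sup>2" by simp
  finally have "sqrt (LINT x|N. f x * f x) \<le> sqrt (measure N (space N) * b\<^sup>2)"
    by (rule real_sqrt_le_mono)
  then show ?thesis
    using \<open>0 \<le> b\<close> by (simp add: l2_norm_def l2_inner_l2_class[OF f f] real_sqrt_mult)
qed

section \<open>The energy space\<close>

text \<open>
  The exponent \<open>\<delta> / 2\<close> makes the form an \<open>L\<^sup>2\<close> inner product: half the integral of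
  \<open>diff_quot \<delta> f * diff_quot \<delta> g\<close> over the product space. On the diagonal the denominator is
  \<open>0 powr (\<delta> / 2) = 0\<close>, hence the quotient is \<open>0\<close> and the diagonal need not be removed.
\<close>

definition diff_quot :: "real \<Rightarrow> ('a::metric_space \<Rightarrow> real) \<Rightarrow> 'a \<times> 'a \<Rightarrow> real" where
  "diff_quot \<delta> f = (\<lambda>(x, y). (f x - f y) / dist x y powr (\<delta> / 2))"

definition energy_space :: "'a::metric_space measure \<Rightarrow> real \<Rightarrow> ('a \<Rightarrow> real) set" where
  "energy_space M \<delta> =
     {f \<in> square_integrable M. diff_quot \<delta> f \<in> square_integrable (M \<Otimes>\<^sub>M M)}"

definition energy_inner ::
    "'a::metric_space measure \<Rightarrow> real \<Rightarrow> ('a \<Rightarrow> real) \<Rightarrow> ('a \<Rightarrow> real) \<Rightarrow> real" where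
  "energy_inner M \<delta> f g =
     (LINT x|M. f x * g x) + 1/2 * (LINT z|(M \<Otimes>\<^sub>M M). diff_quot \<delta> f z * diff_quot \<delta> g z)"

lemma diff_quot_mult:
  "diff_quot \<delta> f (x, y) * diff_quot \<delta> g (x, y) = (f x - f y) * (g x - g y) / dist x y powr \<delta>"
  by (simp add: diff_quot_def powr_add[symmetric])

lemma diff_quot_power2: "(diff_quot \<delta> f (x, y))\<^sup>2 = \<bar>f x - f y\<bar>\<^sup>2 / dist x y powr \<delta>"
  using diff_quot_mult[of \<delta> f x y f] by (simp add: power2_eq_square)

lemma diff_quot_lincomb:
  "diff_quot \<delta> (\<lambda>x. f x + c * g x) = (\<lambda>z. diff_quot \<delta> f z + c * diff_quot \<delta> g z)"
  by (auto simp: diff_quot_def fun_eq_iff add_divide_distrib[symmetric] algebra_simps)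

locale borel_form_space = finite_measure M
  for M :: "'a::{metric_space,second_countable_topology} measure" +
  fixes \<delta> :: real
  assumes sets_M: "sets M = sets borel"
begin

sublocale pair: pair_sigma_finite M M ..

lemma space_M: "space M = UNIV"
  using sets_eq_imp_space_eq[OF sets_M] by simp

lemma borel_measurable_M: "borel_measurable M = borel_measurable (borel :: 'a measure)"
  by (rule measurable_cong_sets) (use sets_M in auto)

lemma sets_pair_M: "sets (M \<Otimes>\<^sub>M M) = sets (borel :: ('a \<times> 'a) measure)"
proof -
  have "sets (M \<Otimes>\<^sub>M M) = sets (borel \<Otimes>\<^sub>M (borel :: 'a measure))"
    by (rule sets_pair_measure_cong) (use sets_M in auto)
  then show ?thesis unfolding borel_prod .
qed

lemma dist_measurable [measurable]: "(\<lambda>z. dist (fst z) (snd z)) \<in> borel_measurable (M \<Otimes>\<^sub>M M)"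
proof -
  have "(\<lambda>z::'a \<times> 'a. dist (fst z) (snd z)) \<in> borel_measurable borel"
    by (intro borel_measurable_continuous_onI continuous_intros)
  then show ?thesis using measurable_cong_sets[OF sets_pair_M refl] by blast
qed

lemma dist_point_measurable [measurable]: "(\<lambda>y. dist x y) \<in> borel_measurable M"
  unfolding borel_measurable_M by (intro borel_measurable_continuous_onI continuous_intros)

lemma diff_quot_measurable [measurable]:
  assumes [measurable]: "f \<in> borel_measurable M"
  shows "diff_quot \<delta> f \<in> borel_measurable (M \<Otimes>\<^sub>M M)"
  unfolding diff_quot_def case_prod_beta by measurable

lemma AE_pair_both:
  assumes "AE x in M. P x"
  shows "AE z in M \<Otimes>\<^sub>M M. P (fst z) \<and> P (snd z)"
proof -
  obtain N where N: "{x \<in> space M. \<not> P x} \<subseteq> N" "emeasure M N = 0" "N \<in> sets M"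
    using AE_E[OF assms] by blast
  show ?thesis
  proof (rule AE_I)
    show "{z \<in> space (M \<Otimes>\<^sub>M M). \<not> (P (fst z) \<and> P (snd z))} \<subseteq> N \<times> space M \<union> space M \<times> N"
      using N(1) by (auto simp: space_pair_measure)
    have "emeasure (M \<Otimes>\<^sub>M M) (N \<times> space M) = 0" "emeasure (M \<Otimes>\<^sub>M M) (space M \<times> N) = 0"
      using N by (simp_all add: emeasure_pair_measure_Times)
    moreover have "N \<times> space M \<in> sets (M \<Otimes>\<^sub>M M)" "space M \<times> N \<in> sets (M \<Otimes>\<^sub>M M)"
      using N(3) by auto
    ultimately show "emeasure (M \<Otimes>\<^sub>M M) (N \<times> space M \<union> space M \<times> N) = 0"
      using emeasure_Un_null_set by (simp add: null_sets_def emeasure_Un_null_set)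
    show "N \<times> space M \<union> space M \<times> N \<in> sets (M \<Otimes>\<^sub>M M)" using N(3) by auto
  qed
qed

lemma diff_quot_cong_AE:
  assumes "AE x in M. f x = g x"
  shows "AE z in M \<Otimes>\<^sub>M M. diff_quot \<delta> f z = diff_quot \<delta> g z"
  using AE_pair_both[OF assms] by eventually_elim (auto simp: diff_quot_def split: prod.splits)

lemma energy_space_cong_AE:
  assumes f: "f \<in> energy_space M \<delta>" and g: "g \<in> square_integrable M" and ae: "AE x in M. f x = g x"
  shows "g \<in> energy_space M \<delta>"
proof -
  have ae': "AE x in M. g x = f x" using ae by eventually_elim simp
  have "diff_quot \<delta> g \<in> square_integrable (M \<Otimes>\<^sub>M M)"
    by (rule square_integrable_cong_AE[OF _ _ diff_quot_cong_AE[OF ae']])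
      (use f g in \<open>auto simp: energy_space_def square_integrable_def\<close>)
  then show ?thesis using g by (simp add: energy_space_def)
qed

lemma energy_inner_cong_AE:
  assumes f: "f \<in> energy_space M \<delta>" and g: "g \<in> energy_space M \<delta>"
    and f': "f' \<in> energy_space M \<delta>" and g': "g' \<in> energy_space M \<delta>"
    and aef: "AE x in M. f x = f' x" and aeg: "AE x in M. g x = g' x"
  shows "energy_inner M \<delta> f g = energy_inner M \<delta> f' g'"
proof -
  have "(LINT x|M. f x * g x) = (LINT x|M. f' x * g' x)"
  proof (rule integral_cong_AE)
    show "AE x in M. f x * g x = f' x * g' x" using aef aeg by eventually_elim simp
  qed (use assms in \<open>auto simp: energy_space_def square_integrable_def\<close>)
  moreover have "(LINT z|(M \<Otimes>\<^sub>M M). diff_quot \<delta> f z * diff_quot \<delta> g z) =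
      (LINT z|(M \<Otimes>\<^sub>M M). diff_quot \<delta> f' z * diff_quot \<delta> g' z)"
  proof (rule integral_cong_AE)
    show "AE z in M \<Otimes>\<^sub>M M. diff_quot \<delta> f z * diff_quot \<delta> g z = diff_quot \<delta> f' z * diff_quot \<delta> g' z"
      using diff_quot_cong_AE[OF aef] diff_quot_cong_AE[OF aeg] by eventually_elim simp
  qed (use assms in \<open>auto simp: energy_space_def square_integrable_def\<close>)
  ultimately show ?thesis by (simp add: energy_inner_def)
qed

lemma square_integrable_imp_energy_space:
  assumes f: "f \<in> square_integrable M"
    and fin: "(\<integral>\<^sup>+x. (\<integral>\<^sup>+y. ennreal (\<bar>f x - f y\<bar>\<^sup>2 / dist x y powr \<delta>) \<partial>M) \<partial>M) < \<infinity>"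
  shows "f \<in> energy_space M \<delta>"
proof -
  have [measurable]: "f \<in> borel_measurable M" using f by (simp add: square_integrable_def)
  have "(\<integral>\<^sup>+z. ennreal ((diff_quot \<delta> f z)\<^sup>2) \<partial>(M \<Otimes>\<^sub>M M)) < \<infinity>"
    using fin by (subst nn_integral_fst[symmetric]) (simp_all add: diff_quot_power2)
  then have "integrable (M \<Otimes>\<^sub>M M) (\<lambda>z. (diff_quot \<delta> f z)\<^sup>2)"
    by (intro integrableI_bounded) auto
  then show ?thesis using f by (simp add: energy_space_def square_integrable_def)
qed

lemma form_dom_iff:
  assumes "F \<in> L2 M"
  shows "F \<in> form_dom M \<delta> \<longleftrightarrow> l2_rep F \<in> energy_space M \<delta>"
proof -
  let ?f = "l2_rep F"
  have f: "?f \<in> square_integrable M" by (rule l2_class_l2_rep(1)[OF assms])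
  then have [measurable]: "?f \<in> borel_measurable M" by (simp add: square_integrable_def)
  have diag: "(\<integral>\<^sup>+y\<in>-{x}. ennreal (\<bar>?f x - ?f y\<bar>\<^sup>2 / dist x y powr \<delta>) \<partial>M) =
      (\<integral>\<^sup>+y. ennreal (\<bar>?f x - ?f y\<bar>\<^sup>2 / dist x y powr \<delta>) \<partial>M)" for x
    by (rule nn_integral_cong) (auto simp: indicator_def)
  have "F \<in> form_dom M \<delta> \<longleftrightarrow>
      (\<integral>\<^sup>+x. (\<integral>\<^sup>+y. ennreal (\<bar>?f x - ?f y\<bar>\<^sup>2 / dist x y powr \<delta>) \<partial>M) \<partial>M) < \<infinity>"
    unfolding form_dom_def mem_Collect_eq diag using assms by blast
  moreover have "(\<integral>\<^sup>+x. (\<integral>\<^sup>+y. ennreal (\<bar>?f x - ?f y\<bar>\<^sup>2 / dist x y powr \<delta>) \<partial>M) \<partial>M) < \<infinity>"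
    if "?f \<in> energy_space M \<delta>"
  proof -
    have "integrable (M \<Otimes>\<^sub>M M) (\<lambda>z. (diff_quot \<delta> ?f z)\<^sup>2)"
      using that by (simp add: energy_space_def square_integrable_def)
    then have "(\<integral>\<^sup>+z. ennreal ((diff_quot \<delta> ?f z)\<^sup>2) \<partial>(M \<Otimes>\<^sub>M M)) < \<infinity>"
      by (simp add: integrable_iff_bounded)
    then show ?thesis
      by (subst (asm) nn_integral_fst[symmetric]) (simp_all add: diff_quot_power2)
  qed
  ultimately show ?thesis using square_integrable_imp_energy_space[OF f] by blast
qed

lemma l2_class_in_form_dom_iff:
  assumes f: "f \<in> square_integrable M"
  shows "l2_class M f \<in> form_dom M \<delta> \<longleftrightarrow> f \<in> energy_space M \<delta>"
proof -
  have ae: "AE x in M. f x = l2_rep (l2_class M f) x"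
    using l2_rep_l2_class(2)[OF f] by eventually_elim simp
  show ?thesis
    using energy_space_cong_AE[OF _ l2_rep_l2_class(1)[OF f] ae]
      energy_space_cong_AE[OF _ f l2_rep_l2_class(2)[OF f]]
    by (auto simp: form_dom_iff[OF l2_class_in_L2[OF f]])
qed

lemma form_dom_eq: "form_dom M \<delta> = l2_class M ` energy_space M \<delta>"
proof -
  have "form_dom M \<delta> \<subseteq> L2 M" by (auto simp: form_dom_def)
  moreover have "energy_space M \<delta> \<subseteq> square_integrable M" by (auto simp: energy_space_def)
  ultimately show ?thesis
    using l2_class_in_form_dom_iff by (fastforce simp: L2_def)
qed

lemma l2_inner_plus_log_form:
  assumes f: "f \<in> energy_space M \<delta>" and g: "g \<in> energy_space M \<delta>"
  shows "l2_inner M (l2_class M f) (l2_class M g) + log_form M \<delta> (l2_class M f) (l2_class M g) =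
    energy_inner M \<delta> f g"
proof -
  let ?f = "l2_rep (l2_class M f)" and ?g = "l2_rep (l2_class M g)"
  have sq: "f \<in> square_integrable M" "g \<in> square_integrable M"
    using f g by (auto simp: energy_space_def)
  have ae: "AE x in M. f x = ?f x" "AE x in M. g x = ?g x"
    using l2_rep_l2_class(2)[OF sq(1)] l2_rep_l2_class(2)[OF sq(2)] by (eventually_elim, simp)+
  have f': "?f \<in> energy_space M \<delta>" and g': "?g \<in> energy_space M \<delta>"
    using energy_space_cong_AE[OF f l2_rep_l2_class(1)[OF sq(1)] ae(1)]
      energy_space_cong_AE[OF g l2_rep_l2_class(1)[OF sq(2)] ae(2)] by auto
  have int: "integrable (M \<Otimes>\<^sub>M M) (\<lambda>z. diff_quot \<delta> ?f z * diff_quot \<delta> ?g z)"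
    using f' g' by (intro square_integrable_mult) (auto simp: energy_space_def)
  have diag: "(LINT y:-{x}|M. (?f x - ?f y) * (?g x - ?g y) / dist x y powr \<delta>) =
      (LINT y|M. diff_quot \<delta> ?f (x, y) * diff_quot \<delta> ?g (x, y))" for x
    unfolding set_lebesgue_integral_def diff_quot_mult
    by (rule Bochner_Integration.integral_cong) (auto simp: indicator_def)
  have "log_form M \<delta> (l2_class M f) (l2_class M g) =
      1/2 * (LINT z|(M \<Otimes>\<^sub>M M). diff_quot \<delta> ?f z * diff_quot \<delta> ?g z)"
    unfolding log_form_def diag using pair.integral_fst'[OF int] by simp
  then have "l2_inner M (l2_class M f) (l2_class M g) +
      log_form M \<delta> (l2_class M f) (l2_class M g) = energy_inner M \<delta> ?f ?g"
    by (simp add: l2_inner_def energy_inner_def)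
  also have "\<dots> = energy_inner M \<delta> f g"
    by (rule energy_inner_cong_AE[OF f g f' g' ae, symmetric])
  finally show ?thesis .
qed

lemma energy_space_lincomb:
  assumes "f \<in> energy_space M \<delta>" "g \<in> energy_space M \<delta>"
  shows "(\<lambda>x. f x + c * g x) \<in> energy_space M \<delta>"
  using assms by (simp add: energy_space_def diff_quot_lincomb square_integrable_lincomb)

lemma energy_inner_lincomb:
  assumes f: "f \<in> energy_space M \<delta>" and g: "g \<in> energy_space M \<delta>" and k: "k \<in> energy_space M \<delta>"
  shows "energy_inner M \<delta> (\<lambda>x. f x + c * g x) k = energy_inner M \<delta> f k + c * energy_inner M \<delta> g k"
proof -
  have "integrable M (\<lambda>x. u x * k x)" "integrable (M \<Otimes>\<^sub>M M) (\<lambda>z. diff_quot \<delta> u z * diff_quot \<delta> k z)"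
    if "u \<in> energy_space M \<delta>" for u
    using that k by (auto simp: energy_space_def intro: square_integrable_mult)
  then show ?thesis
    using f g by (simp add: energy_inner_def diff_quot_lincomb ring_distribs mult.assoc)
qed

lemma energy_inner_commute: "energy_inner M \<delta> f g = energy_inner M \<delta> g f"
  by (simp add: energy_inner_def mult.commute)

lemma energy_inner_self:
  "energy_inner M \<delta> f f = (LINT x|M. (f x)\<^sup>2) + 1/2 * (LINT z|(M \<Otimes>\<^sub>M M). (diff_quot \<delta> f z)\<^sup>2)"
  by (simp add: energy_inner_def power2_eq_square)

lemma energy_inner_self_ge:
  shows "0 \<le> energy_inner M \<delta> f f" "(LINT x|M. (f x)\<^sup>2) \<le> energy_inner M \<delta> f f"
    "(LINT z|(M \<Otimes>\<^sub>M M). (diff_quot \<delta> f z)\<^sup>2) \<le> 2 * energy_inner M \<delta> f f"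
  unfolding energy_inner_self
  using Bochner_Integration.integral_nonneg[of M "\<lambda>x. (f x)\<^sup>2"]
    Bochner_Integration.integral_nonneg[of "M \<Otimes>\<^sub>M M" "\<lambda>z. (diff_quot \<delta> f z)\<^sup>2"] by simp_all

text \<open>
  The arithmetic-geometric inequality \<open>\<bar>a\<bar> \<le> 2 ^ n * a\<^sup>2 + (1/2) ^ n\<close>, weighted against the rate
  \<open>(1/4) ^ n\<close> of the squares, makes the increments absolutely summable in \<open>L\<^sup>1\<close>, as the measure is
  finite. Thus they are absolutely summable at almost every point.
\<close>

lemma fast_cauchy_AE_convergent:
  assumes u: "\<And>n. u n \<in> square_integrable M"
    and fast: "\<And>n. (LINT x|M. (u (Suc n) x - u n x)\<^sup>2) \<le> (1/4) ^ n"
  shows "AE x in M. convergent (\<lambda>n. u n x)"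
proof -
  have [measurable]: "u n \<in> borel_measurable M" for n
    using u by (simp add: square_integrable_def)
  have sq: "(\<lambda>x. u (Suc n) x - u n x) \<in> square_integrable M" for n
    by (intro square_integrable_diff u)
  have step: "(\<integral>\<^sup>+x. ennreal \<bar>u (Suc n) x - u n x\<bar> \<partial>M) \<le> ennreal ((1 + measure M (space M)) * (1/2) ^ n)"
    for n
  proof -
    have amgm: "\<bar>a\<bar> \<le> 2 ^ n * a\<^sup>2 + (1/2) ^ n" for a :: real
    proof -
      have "0 \<le> (2 ^ n * \<bar>a\<bar> - 1)\<^sup>2" by simp
      then have "2 * (2 ^ n * \<bar>a\<bar>) \<le> 2 ^ n * (2 ^ n * a\<^sup>2) + 1"
        by (simp add: power2_eq_square algebra_simps)
      moreover have "2 ^ n * (2 ^ n * a\<^sup>2) + 1 = 2 ^ n * (2 ^ n * a\<^sup>2 + (1/2) ^ n)"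
        by (simp add: ring_distribs power_mult_distrib[symmetric])
      ultimately have "2 ^ n * (2 * \<bar>a\<bar>) \<le> 2 ^ n * (2 ^ n * a\<^sup>2 + (1/2) ^ n)" by linarith
      then have "2 * \<bar>a\<bar> \<le> 2 ^ n * a\<^sup>2 + (1/2) ^ n" by simp
      then show ?thesis by linarith
    qed
    have "(\<integral>\<^sup>+x. ennreal \<bar>u (Suc n) x - u n x\<bar> \<partial>M) \<le>
        (\<integral>\<^sup>+x. ennreal (2 ^ n * (u (Suc n) x - u n x)\<^sup>2 + (1/2) ^ n) \<partial>M)"
      by (intro nn_integral_mono ennreal_leI amgm)
    also have "\<dots> = ennreal (LINT x|M. 2 ^ n * (u (Suc n) x - u n x)\<^sup>2 + (1/2) ^ n)"
      using sq[of n] by (intro nn_integral_eq_integral) (auto simp: square_integrable_def)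
    also have "(LINT x|M. 2 ^ n * (u (Suc n) x - u n x)\<^sup>2 + (1/2) ^ n) =
        2 ^ n * (LINT x|M. (u (Suc n) x - u n x)\<^sup>2) + measure M (space M) * (1/2) ^ n"
      using sq[of n] by (simp add: square_integrable_def)
    also have "\<dots> \<le> 2 ^ n * (1/4) ^ n + measure M (space M) * (1/2) ^ n"
      using fast[of n] by simp
    also have "\<dots> = (1 + measure M (space M)) * (1/2) ^ n"
      by (simp add: power_mult_distrib[symmetric] ring_distribs)
    finally show ?thesis by (simp add: ennreal_leI)
  qed
  have "(\<integral>\<^sup>+x. (\<Sum>n. ennreal \<bar>u (Suc n) x - u n x\<bar>) \<partial>M) =
      (\<Sum>n. \<integral>\<^sup>+x. ennreal \<bar>u (Suc n) x - u n x\<bar> \<partial>M)"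
    by (rule nn_integral_suminf) simp
  also have "\<dots> \<le> (\<Sum>n. ennreal ((1 + measure M (space M)) * (1/2) ^ n))"
    by (intro suminf_le step) auto
  also have "\<dots> = ennreal (\<Sum>n. (1 + measure M (space M)) * (1/2) ^ n)"
    by (intro suminf_ennreal2 summable_mult summable_geometric) auto
  also have "\<dots> < \<infinity>" by simp
  finally have "AE x in M. (\<Sum>n. ennreal \<bar>u (Suc n) x - u n x\<bar>) \<noteq> \<infinity>"
    by (intro nn_integral_PInf_AE) auto
  then show ?thesis
  proof eventually_elim
    case (elim x)
    then have "summable (\<lambda>n. \<bar>u (Suc n) x - u n x\<bar>)"
      by (intro summable_suminf_not_top) (auto simp: top_ennreal_def)
    then have "summable (\<lambda>n. u (Suc n) x - u n x)"
      by (rule summable_rabs_cancel)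
    then have "convergent (\<lambda>n. \<Sum>i<n. u (Suc i) x - u i x)"
      by (simp add: summable_iff_convergent)
    then have "convergent (\<lambda>n. u 0 x + (\<Sum>i<n. u (Suc i) x - u i x))"
      by (intro convergent_add convergent_const)
    then show ?case by (simp add: sum_lessThan_telescope[of "\<lambda>i. u i x"])
  qed
qed

text \<open>
  The form is closed: the almost everywhere limit of a fast Cauchy sequence is its limit in the
  energy norm, since Fatou bounds the distance from \<open>u n\<close> to the limit by the distances from
  \<open>u n\<close> to the later terms.
\<close>

lemma energy_space_complete:
  assumes u: "\<And>n. u n \<in> energy_space M \<delta>"
    and fast: "\<And>m n. n \<le> m \<Longrightarrow>
      energy_inner M \<delta> (\<lambda>x. u m x - u n x) (\<lambda>x. u m x - u n x) \<le> (1/4) ^ n"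
  shows "\<exists>f\<in>energy_space M \<delta>.
    (\<lambda>n. energy_inner M \<delta> (\<lambda>x. u n x - f x) (\<lambda>x. u n x - f x)) \<longlonglongrightarrow> 0"
proof -
  have usq: "u n \<in> square_integrable M" for n using u by (simp add: energy_space_def)
  have [measurable]: "u n \<in> borel_measurable M" for n
    using usq by (simp add: square_integrable_def)
  have "AE x in M. convergent (\<lambda>n. u n x)"
  proof (rule fast_cauchy_AE_convergent[OF usq])
    show "(LINT x|M. (u (Suc n) x - u n x)\<^sup>2) \<le> (1/4) ^ n" for n
      using energy_inner_self_ge(2)[of "\<lambda>x. u (Suc n) x - u n x"] fast[of n "Suc n"] by simp
  qed
  moreover define f where "f x = lim (\<lambda>n. u n x)" for x
  ultimately have lim: "AE x in M. (\<lambda>n. u n x) \<longlonglongrightarrow> f x"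
    by (simp add: convergent_LIMSEQ_iff)
  have f[measurable]: "f \<in> borel_measurable M"
    unfolding f_def by (rule borel_measurable_lim_metric) measurable
  have diff: "(\<lambda>x. u m x - u n x) \<in> energy_space M \<delta>" for m n
    using energy_space_lincomb[OF u u, of m "-1" n] by simp
  have bound: "(\<lambda>x. f x - u n x) \<in> energy_space M \<delta> \<and>
      energy_inner M \<delta> (\<lambda>x. f x - u n x) (\<lambda>x. f x - u n x) \<le> 2 * (1/4) ^ n" for n
  proof -
    have 1: "(\<lambda>x. f x - u n x) \<in> square_integrable M \<and> (LINT x|M. (f x - u n x)\<^sup>2) \<le> (1/4) ^ n"
    proof (rule square_integrable_fatou[where u = "\<lambda>m x. u m x - u n x" and k = n])
      show "AE x in M. (\<lambda>m. u m x - u n x) \<longlonglongrightarrow> f x - u n x"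
        using lim by eventually_elim (intro tendsto_intros)
      show "(LINT x|M. (u m x - u n x)\<^sup>2) \<le> (1/4) ^ n" if "n \<le> m" for m
        using energy_inner_self_ge(2)[of "\<lambda>x. u m x - u n x"] fast[OF that] by simp
    qed (auto intro: square_integrable_diff usq)
    have 2: "diff_quot \<delta> (\<lambda>x. f x - u n x) \<in> square_integrable (M \<Otimes>\<^sub>M M) \<and>
        (LINT z|(M \<Otimes>\<^sub>M M). (diff_quot \<delta> (\<lambda>x. f x - u n x) z)\<^sup>2) \<le> 2 * (1/4) ^ n"
    proof (rule square_integrable_fatou[where u = "\<lambda>m. diff_quot \<delta> (\<lambda>x. u m x - u n x)" and k = n])
      show "diff_quot \<delta> (\<lambda>x. u m x - u n x) \<in> square_integrable (M \<Otimes>\<^sub>M M)" for m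
        using diff by (simp add: energy_space_def)
      show "AE z in M \<Otimes>\<^sub>M M. (\<lambda>m. diff_quot \<delta> (\<lambda>x. u m x - u n x) z)
          \<longlonglongrightarrow> diff_quot \<delta> (\<lambda>x. f x - u n x) z"
        using AE_pair_both[OF lim]
      proof eventually_elim
        case (elim z)
        then show ?case
          unfolding diff_quot_def case_prod_beta divide_inverse
          by (intro tendsto_mult tendsto_diff tendsto_const) auto
      qed
      show "(LINT z|(M \<Otimes>\<^sub>M M). (diff_quot \<delta> (\<lambda>x. u m x - u n x) z)\<^sup>2) \<le> 2 * (1/4) ^ n"
        if "n \<le> m" for m
        using energy_inner_self_ge(3)[of "\<lambda>x. u m x - u n x"] fast[OF that] by simp
    qed simp
    show ?thesis using 1 2 by (simp add: energy_space_def energy_inner_self)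
  qed
  have "(\<lambda>x. (f x - u 0 x) + 1 * u 0 x) \<in> energy_space M \<delta>"
    using bound[of 0] u by (intro energy_space_lincomb) auto
  then have fE: "f \<in> energy_space M \<delta>" by simp
  have neg: "energy_inner M \<delta> (\<lambda>x. u n x - f x) (\<lambda>x. u n x - f x) =
      energy_inner M \<delta> (\<lambda>x. f x - u n x) (\<lambda>x. f x - u n x)" for n
  proof -
    have "diff_quot \<delta> (\<lambda>x. u n x - f x) = (\<lambda>z. - diff_quot \<delta> (\<lambda>x. f x - u n x) z)"
      by (auto simp: diff_quot_def fun_eq_iff minus_divide_left)
    then show ?thesis by (simp add: energy_inner_self power2_commute[of "u n _"])
  qed
  have "(\<lambda>n. energy_inner M \<delta> (\<lambda>x. u n x - f x) (\<lambda>x. u n x - f x)) \<longlonglongrightarrow> 0"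
  proof (rule tendsto_sandwich[where f = "\<lambda>_. 0"])
    have "(\<lambda>n. 2 * (1/4) ^ n :: real) \<longlonglongrightarrow> 2 * 0"
      by (intro tendsto_intros LIMSEQ_realpow_zero) auto
    then show "(\<lambda>n. 2 * (1/4) ^ n :: real) \<longlonglongrightarrow> 0" by simp
  qed (use bound neg energy_inner_self_ge(1) in auto)
  then show ?thesis using fE by blast
qed

section \<open>The resolvent\<close>

text \<open>
  The equation that defines \<open>u = R f\<close>, for functions instead of classes.
\<close>

definition weak_solution :: "('a \<Rightarrow> real) \<Rightarrow> ('a \<Rightarrow> real) \<Rightarrow> bool" where
  "weak_solution f u \<longleftrightarrow> u \<in> energy_space M \<delta> \<and>
     (\<forall>g\<in>energy_space M \<delta>. energy_inner M \<delta> u g = (LINT x|M. f x * g x))"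

lemma weak_solution_exists:
  assumes f: "f \<in> square_integrable M"
  shows "\<exists>u. weak_solution f u"
proof -
  have "\<exists>u\<in>energy_space M \<delta>. \<forall>g\<in>energy_space M \<delta>. energy_inner M \<delta> u g = (LINT x|M. f x * g x)"
  proof (rule riesz_by_minimization[where K = "LINT x|M. (f x)\<^sup>2"])
    have "(\<lambda>x. 0) \<in> energy_space M \<delta>"
      by (simp add: energy_space_def square_integrable_def diff_quot_def case_prod_beta)
    then show "energy_space M \<delta> \<noteq> {}" by blast
    show "(LINT x|M. f x * (g x + c * k x)) = (LINT x|M. f x * g x) + c * (LINT x|M. f x * k x)"
      if "g \<in> energy_space M \<delta>" "k \<in> energy_space M \<delta>" for g k c
    proof -
      have "integrable M (\<lambda>x. f x * g x)" "integrable M (\<lambda>x. f x * k x)"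
        using that f by (auto simp: energy_space_def intro: square_integrable_mult)
      then show ?thesis by (simp add: ring_distribs mult.left_commute)
    qed
    show "(LINT x|M. f x * g x)\<^sup>2 \<le> (LINT x|M. (f x)\<^sup>2) * energy_inner M \<delta> g g"
      if "g \<in> energy_space M \<delta>" for g
    proof -
      have "(LINT x|M. f x * g x)\<^sup>2 \<le> (LINT x|M. (f x)\<^sup>2) * (LINT x|M. (g x)\<^sup>2)"
        using that f by (intro square_integrable_cauchy_schwarz) (auto simp: energy_space_def)
      also have "\<dots> \<le> (LINT x|M. (f x)\<^sup>2) * energy_inner M \<delta> g g"
        by (intro mult_left_mono energy_inner_self_ge(2)) simp
      finally show ?thesis .
    qed
  qed (auto intro: energy_space_lincomb energy_inner_lincomb energy_inner_commute
      energy_inner_self_ge(1) energy_space_complete)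
  then show ?thesis by (auto simp: weak_solution_def)
qed

lemma weak_solution_unique:
  assumes u: "weak_solution f u" and v: "weak_solution f v"
  shows "l2_class M u = l2_class M v"
proof -
  let ?w = "\<lambda>x. u x + (-1) * v x"
  have uE: "u \<in> energy_space M \<delta>" and vE: "v \<in> energy_space M \<delta>"
    using u v by (auto simp: weak_solution_def)
  have wE: "?w \<in> energy_space M \<delta>" by (rule energy_space_lincomb[OF uE vE])
  have "energy_inner M \<delta> ?w ?w = 0"
    using u v wE unfolding energy_inner_lincomb[OF uE vE wE] by (simp add: weak_solution_def)
  then have "(LINT x|M. (?w x)\<^sup>2) \<le> 0" using energy_inner_self_ge(2)[of ?w] by simp
  moreover have "0 \<le> (LINT x|M. (?w x)\<^sup>2)" by (rule Bochner_Integration.integral_nonneg) simp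
  ultimately have "(LINT x|M. (?w x)\<^sup>2) = 0" by (rule antisym)
  moreover have "integrable M (\<lambda>x. (?w x)\<^sup>2)"
    using wE by (simp add: energy_space_def square_integrable_def)
  ultimately have "AE x in M. (?w x)\<^sup>2 = 0"
    using integral_nonneg_eq_0_iff_AE[of M "\<lambda>x. (?w x)\<^sup>2"] by simp
  then have "AE x in M. u x = v x" by eventually_elim simp
  then show ?thesis
    using uE vE by (subst l2_class_eq_iff) (auto simp: energy_space_def)
qed

text \<open>
  The description of the resolvent has exactly one solution, so its value can be read off from any
  weak solution. Together with \<open>weak_solution_exists\<close> this makes the resolvent of every
  square-integrable function meaningful.
\<close>

lemma log_resolvent_l2_class:
  assumes f: "f \<in> square_integrable M" and u: "weak_solution f u"
  shows "log_resolvent M \<delta> (l2_class M f) = l2_class M u"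
proof -
  have iff: "(\<forall>G\<in>form_dom M \<delta>. l2_inner M (l2_class M v) G + log_form M \<delta> (l2_class M v) G =
      l2_inner M (l2_class M f) G) \<longleftrightarrow> weak_solution f v" if v: "v \<in> energy_space M \<delta>" for v
  proof -
    have "l2_inner M (l2_class M f) (l2_class M g) = (LINT x|M. f x * g x)"
      if "g \<in> energy_space M \<delta>" for g
      using that f by (intro l2_inner_l2_class) (auto simp: energy_space_def)
    then show ?thesis
      using v by (simp add: form_dom_eq weak_solution_def l2_inner_plus_log_form)
  qed
  have uE: "u \<in> energy_space M \<delta>" using u by (simp add: weak_solution_def)
  show ?thesis
    unfolding log_resolvent_def
  proof (rule the_equality)
    show "l2_class M u \<in> form_dom M \<delta> \<and> (\<forall>G\<in>form_dom M \<delta>. l2_inner M (l2_class M u) G +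
        log_form M \<delta> (l2_class M u) G = l2_inner M (l2_class M f) G)"
      using iff[OF uE] u uE by (simp add: form_dom_eq)
  next
    fix U assume U: "U \<in> form_dom M \<delta> \<and> (\<forall>G\<in>form_dom M \<delta>. l2_inner M U G +
        log_form M \<delta> U G = l2_inner M (l2_class M f) G)"
    then obtain v where v: "v \<in> energy_space M \<delta>" "U = l2_class M v" by (auto simp: form_dom_eq)
    then have "weak_solution f v" using U iff by blast
    then show "U = l2_class M u" using weak_solution_unique[OF _ u] v(2) by blast
  qed
qed

end

section \<open>Bounded Lipschitz functions separate integrable functions\<close>

context borel_form_space begin

text \<open>
  The truncations \<open>max 0 (1 - n * infdist x A)\<close> are bounded and Lipschitz and decrease to the
  indicator of the closed set \<open>A\<close>. Hence the integral of \<open>\<phi>\<close> over every closed set vanishes; the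
  closed sets are stable under intersection and generate the Borel sets, so the same holds for all
  measurable sets.
\<close>

lemma lipschitz_separating:
  fixes \<phi> :: "'a \<Rightarrow> real"
  assumes \<phi>: "integrable M \<phi>"
    and zero: "\<And>g L. L-lipschitz_on UNIV g \<Longrightarrow> bounded (range g) \<Longrightarrow> (LINT x|M. \<phi> x * g x) = 0"
  shows "AE x in M. \<phi> x = 0"
proof -
  have [measurable]: "\<phi> \<in> borel_measurable M" using \<phi> by auto
  have closed0: "(LINT x:A|M. \<phi> x) = 0" if "closed A" for A
  proof (cases "A = {}")
    case False
    define g where "g n x = max 0 (1 - real n * infdist x A)" for n :: nat and x
    have lip: "(real n)-lipschitz_on UNIV (g n)" for n
    proof (rule lipschitz_onI)
      fix x y
      have "\<bar>real n * infdist x A - real n * infdist y A\<bar> \<le> real n * dist x y"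
        using mult_left_mono[OF infdist_triangle_abs[of x A y], of "real n"]
        by (simp add: abs_mult right_diff_distrib[symmetric])
      then show "dist (g n x) (g n y) \<le> real n * dist x y"
        by (auto simp: g_def dist_real_def)
    qed simp
    have g01: "0 \<le> g n x" "g n x \<le> 1" for n x
      by (auto simp: g_def infdist_nonneg)
    have "bounded (range (g n))" for n
      by (rule boundedI[of _ 1]) (use g01 in auto)
    then have zero_n: "(LINT x|M. \<phi> x * g n x) = 0" for n by (rule zero[OF lip])
    have meas: "g n \<in> borel_measurable M" for n
      unfolding borel_measurable_M
      using lip lipschitz_on_continuous_on by (blast intro: borel_measurable_continuous_onI)
    have ptw: "(\<lambda>n. g n x) \<longlonglongrightarrow> indicator A x" for x
    proof (cases "x \<in> A")
      case True
      then show ?thesis by (simp add: g_def)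
    next
      case out: False
      then have pos: "infdist x A > 0"
        using in_closed_iff_infdist_zero[OF that False, of x] infdist_nonneg[of x A] by linarith
      obtain k :: nat where k: "1 / infdist x A < real k" using reals_Archimedean2 by blast
      have "g n x = 0" if "n \<ge> k" for n
      proof -
        have "1 < real k * infdist x A" using k pos by (simp add: field_simps)
        also have "\<dots> \<le> real n * infdist x A" using that pos by simp
        finally show ?thesis by (simp add: g_def)
      qed
      then have "\<forall>\<^sub>F n in sequentially. g n x = 0" by (auto simp: eventually_sequentially)
      then show ?thesis using out by (simp add: tendsto_eventually)
    qed
    have Am: "A \<in> sets M" using that by (simp add: sets_M)
    have "(\<lambda>n. LINT x|M. \<phi> x * g n x) \<longlonglongrightarrow> (LINT x|M. \<phi> x * indicator A x)"
    proof (rule integral_dominated_convergence[where w = "\<lambda>x. \<bar>\<phi> x\<bar>"])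
      show "AE x in M. (\<lambda>n. \<phi> x * g n x) \<longlonglongrightarrow> \<phi> x * indicator A x"
        by (intro AE_I2 tendsto_mult tendsto_const ptw)
      show "AE x in M. norm (\<phi> x * g n x) \<le> \<bar>\<phi> x\<bar>" for n
        using g01 by (auto simp: abs_mult intro!: mult_left_le)
    qed (use \<phi> meas Am in auto)
    then have "(LINT x|M. \<phi> x * indicator A x) = 0"
      by (simp add: zero_n LIMSEQ_const_iff)
    then show ?thesis by (simp add: set_lebesgue_integral_def mult.commute)
  qed (simp add: set_lebesgue_integral_def)
  have si: "set_integrable M A \<phi>" if "A \<in> sets M" for A
    unfolding set_integrable_def by (rule integrable_mult_indicator[OF that \<phi>])
  have "(LINT x:A|M. \<phi> x) = 0" if "A \<in> sets M" for A
  proof -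
    have "Int_stable (Collect closed :: 'a set set)" by (auto simp: Int_stable_def)
    moreover have "Collect closed \<subseteq> Pow (UNIV :: 'a set)" by simp
    moreover have "A \<in> sigma_sets UNIV (Collect closed)"
      using that by (simp add: sets_M borel_eq_closed)
    ultimately show ?thesis
    proof (induction rule: sigma_sets_induct_disjoint)
      case (basic A)
      then show ?case using closed0 by simp
    next
      case (compl A)
      have Am: "A \<in> sets M" using compl(1) by (simp add: sets_M borel_eq_closed)
      have "(LINT x:A \<union> (UNIV - A)|M. \<phi> x) = (LINT x:A|M. \<phi> x) + (LINT x:UNIV - A|M. \<phi> x)"
        by (rule set_integral_Un) (use Am sets.compl_sets[OF Am] space_M in \<open>auto intro!: si\<close>)
      then show ?case using compl(2) closed0[of UNIV] by simp
    next
      case (union A)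
      have Am: "A i \<in> sets M" for i using union(2) by (auto simp: sets_M borel_eq_closed)
      have "(LINT x:(\<Union>i. A i)|M. \<phi> x) = (\<Sum>i. LINT x:A i|M. \<phi> x)"
        by (rule lebesgue_integral_countable_add)
          (use Am union(1) in \<open>auto simp: disjoint_family_on_def intro!: si\<close>)
      then show ?case using union(3) by simp
    qed (simp add: set_lebesgue_integral_def)
  qed
  then show ?thesis
    using density_unique_real[OF \<phi>, of "\<lambda>_. 0"] by (simp add: set_lebesgue_integral_def)
qed

end

section \<open>The kernel bound for Dini functions\<close>

lemma dini_space_le_sup:
  assumes "h \<in> dini_space"
  shows "\<bar>h x\<bar> \<le> (SUP x. \<bar>h x\<bar>)"
proof (rule cSUP_upper)
  obtain b where "\<And>x. \<bar>h x\<bar> \<le> b" using assms by (auto simp: dini_space_def bounded_iff)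
  then show "bdd_above (range (\<lambda>x. \<bar>h x\<bar>))" by (rule bdd_aboveI2)
qed simp

lemma dini_norm_ge:
  assumes "h \<in> dini_space"
  shows "(SUP x. \<bar>h x\<bar>) \<le> dini_norm h" "0 \<le> (SUP x. \<bar>h x\<bar>)" "0 \<le> dini_norm h"
proof -
  show "0 \<le> (SUP x. \<bar>h x\<bar>)"
    using dini_space_le_sup[OF assms, of undefined] by linarith
  then show "(SUP x. \<bar>h x\<bar>) \<le> dini_norm h" "0 \<le> dini_norm h"
    by (simp_all add: dini_norm_def)
qed

locale ahlfors_form_space = borel_form_space +
  assumes delta_pos: "\<delta> > 0" and ahlfors: "ahlfors_regular M \<delta>"
begin

text \<open>
  On an unbounded space the lower regularity bound would hold for all radii and contradict the
  finiteness of the measure.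
\<close>

lemma bounded_UNIV: "bounded (UNIV :: 'a set)"
proof (rule ccontr)
  assume unbdd: "\<not> bounded (UNIV :: 'a set)"
  have dist_le: "ereal (dist x y) \<le> ediam TYPE('a)" for x y :: 'a
    unfolding ediam_def by (rule SUP_upper2[of "(x, y)"]) auto
  have inf: "ediam TYPE('a) = \<infinity>"
  proof (cases "ediam TYPE('a)")
    case (real s)
    then have "\<forall>y. dist (undefined :: 'a) y \<le> s" using dist_le[of undefined] by simp
    then have "bounded (UNIV :: 'a set)" unfolding bounded_def by blast
    then show ?thesis using unbdd by blast
  next
    case MInf
    then show ?thesis using dist_le[of undefined undefined] by simp
  qed simp
  obtain C where C: "C \<ge> 1" "\<And>(x::'a) r. 0 \<le> r \<Longrightarrow> inverse C * r powr \<delta> \<le> measure M (cball x r)"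
    using ahlfors inf unfolding ahlfors_regular_def by auto
  define r where "r = (C * (measure M (space M) + 1)) powr (1 / \<delta>)"
  have "inverse C * r powr \<delta> \<le> measure M (space M)"
    using C(2)[of r undefined] bounded_measure[of "cball undefined r"] by (simp add: r_def)
  moreover have "inverse C * r powr \<delta> = measure M (space M) + 1"
    using C(1) delta_pos by (simp add: r_def powr_powr)
  ultimately show False by simp
qed

lemma dist_le_diam: "dist (x::'a) y \<le> diameter (UNIV :: 'a set)"
  by (rule diameter_bounded_bound[OF bounded_UNIV]) auto

text \<open>
  Regularity controls only radii below the diameter. From there on every ball is bounded by the total
  mass, which a larger constant absorbs. On a one-point space this fails at \<open>r = 0\<close>, whence the
  assumption.
\<close>

lemma ball_measure_le:
  assumes "0 < diameter (UNIV :: 'a set)"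
  shows "\<exists>C\<ge>0. \<forall>(x::'a) r. 0 \<le> r \<longrightarrow> measure M (cball x r) \<le> C * r powr \<delta>"
proof -
  obtain C where C: "C \<ge> 1" "\<And>(x::'a) r. 0 \<le> r \<Longrightarrow> r < diameter (UNIV :: 'a set) \<Longrightarrow> measure M (cball x r) \<le> C * r powr \<delta>"
    using ahlfors unfolding ahlfors_regular_def ediam_eq_diameter[OF bounded_UNIV] by auto
  define E where "E = max C (measure M (space M) / diameter (UNIV :: 'a set) powr \<delta>)"
  have E0: "E \<ge> 0" using C(1) by (simp add: E_def)
  have "measure M (cball x r) \<le> E * r powr \<delta>" if "0 \<le> r" for x r
  proof (cases "r < diameter (UNIV :: 'a set)")
    case True
    have "C * r powr \<delta> \<le> E * r powr \<delta>" by (intro mult_right_mono) (auto simp: E_def)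
    then show ?thesis using C(2)[OF that True, of x] by linarith
  next
    case False
    have "measure M (cball x r) \<le> measure M (space M) / diameter (UNIV :: 'a set) powr \<delta> * diameter (UNIV :: 'a set) powr \<delta>"
      using bounded_measure assms by simp
    also have "\<dots> \<le> E * r powr \<delta>"
      using False assms delta_pos E0 by (intro mult_mono powr_mono2) (auto simp: E_def)
    finally show ?thesis .
  qed
  then show ?thesis using E0 by blast
qed

lemma ball_measure_pos:
  assumes "emeasure M UNIV \<noteq> 0" "r > 0"
  shows "measure M (cball (x::'a) r) > 0"
proof (cases "diameter (UNIV :: 'a set) > 0")
  case True
  obtain C where C: "C \<ge> 1" "\<And>(x::'a) r. 0 \<le> r \<Longrightarrow> r < diameter (UNIV :: 'a set) \<Longrightarrow> inverse C * r powr \<delta> \<le> measure M (cball x r)"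
    using ahlfors unfolding ahlfors_regular_def ediam_eq_diameter[OF bounded_UNIV] by auto
  define s where "s = min r (diameter (UNIV :: 'a set) / 2)"
  have "0 < inverse C * s powr \<delta>" using C(1) assms True by (simp add: s_def)
  also have "\<dots> \<le> measure M (cball x s)" using True assms by (intro C(2)) (auto simp: s_def)
  also have "\<dots> \<le> measure M (cball x r)"
    by (intro finite_measure_mono) (auto simp: sets_M s_def)
  finally show ?thesis .
next
  case False
  then have "cball x r = UNIV" using order_trans[OF dist_le_diam[of x], of r] \<open>r > 0\<close> by auto
  then show ?thesis using assms(1) measure_nonneg[of M UNIV] by (auto simp: emeasure_eq_measure less_le)
qed

lemma modulus_bdd_above:
  assumes "h \<in> dini_space"
  shows "bdd_above {\<bar>h x - h y\<bar> | x y. dist (x::'a) y \<le> t * diameter (UNIV :: 'a set)}"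
proof (rule bdd_aboveI)
  fix v assume "v \<in> {\<bar>h x - h y\<bar> | x y. dist (x::'a) y \<le> t * diameter (UNIV :: 'a set)}"
  then obtain x y where "v = \<bar>h x - h y\<bar>" by blast
  then show "v \<le> 2 * (SUP x. \<bar>h x\<bar>)"
    using dini_space_le_sup[OF assms, of x] dini_space_le_sup[OF assms, of y] by linarith
qed

lemma diff_le_modulus:
  assumes "h \<in> dini_space" "dist (x::'a) y \<le> t * diameter (UNIV :: 'a set)"
  shows "\<bar>h x - h y\<bar> \<le> modulus h t"
  unfolding modulus_def by (rule cSup_upper) (use assms modulus_bdd_above in auto)

lemma modulus_mono:
  assumes h: "h \<in> dini_space" and st: "0 \<le> s" "s \<le> t"
  shows "modulus (h :: 'a \<Rightarrow> real) s \<le> modulus h t"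
  unfolding modulus_def
proof (rule cSup_subset_mono[OF _ modulus_bdd_above[OF h]])
  have "0 \<le> diameter (UNIV :: 'a set)" using dist_le_diam[of undefined undefined] by simp
  then have le: "s * diameter (UNIV :: 'a set) \<le> t * diameter (UNIV :: 'a set)" and "0 \<le> s * diameter (UNIV :: 'a set)" using st by (auto intro: mult_right_mono)
  then show "{\<bar>h x - h y\<bar> | x y. dist (x::'a) y \<le> s * diameter (UNIV :: 'a set)} \<noteq> {}"
    by (auto intro!: exI[of _ undefined])
  show "{\<bar>h x - h y\<bar> | x y. dist (x::'a) y \<le> s * diameter (UNIV :: 'a set)} \<subseteq> {\<bar>h x - h y\<bar> | x y. dist (x::'a) y \<le> t * diameter (UNIV :: 'a set)}"
    using le by (blast intro: order_trans)
qed

text \<open>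
  The truncation matters: for negative \<open>t\<close> on a space of positive diameter the modulus is the
  supremum of the empty set, and monotonicity holds only on the nonnegative half-line.
\<close>

lemma modulus_measurable:
  assumes "h \<in> dini_space"
  shows "(\<lambda>t. modulus (h :: 'a \<Rightarrow> real) (max 0 t)) \<in> borel_measurable borel"
  by (rule borel_measurable_mono) (auto intro!: monoI modulus_mono assms)

lemma dini_space_measurable:
  assumes "h \<in> dini_space"
  shows "h \<in> borel_measurable M"
  unfolding borel_measurable_M
  by (rule borel_measurable_continuous_onI)
    (use assms in \<open>auto simp: dini_space_def intro: uniformly_continuous_imp_continuous\<close>)

text \<open>
  With \<open>s = dist x y / diameter UNIV\<close>, the modulus at every \<open>t \<in> {s..2 * s}\<close> dominates
  \<open>\<bar>h x - h y\<bar>\<close>, while \<open>t\<close> and \<open>s\<close> are comparable; averaging over this interval of length \<open>s\<close>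
  replaces the singular quotient by an integral in \<open>t\<close>. The assumption that the points are at most
  half the diameter apart keeps \<open>{s..2 * s}\<close> inside the range of the Dini integral.
\<close>

lemma near_kernel_le:
  fixes h :: "'a \<Rightarrow> real"
  assumes h: "h \<in> dini_space" and near: "0 < dist x y" "dist x y \<le> diameter (UNIV :: 'a set) / 2"
  shows "ennreal (\<bar>h x - h y\<bar> / dist x y powr \<delta>) \<le>
    (\<integral>\<^sup>+t. ennreal (2 powr (1 + \<delta>) * (modulus h (max 0 t) / t) * (t * diameter (UNIV :: 'a set)) powr (- \<delta>)) *
      indicator {t. 0 < t \<and> t \<le> 1 \<and> dist x y \<le> t * diameter (UNIV :: 'a set)} t \<partial>lborel)"
proof -
  let ?D = "diameter (UNIV :: 'a set)"
  define s where "s = dist x y / ?D"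
  have D: "?D > 0" using near by linarith
  have s: "0 < s" "2 * s \<le> 1" using near D by (auto simp: s_def field_simps)
  have sD: "s * ?D = dist x y" using D by (simp add: s_def)
  define c where "c = \<bar>h x - h y\<bar> / dist x y powr \<delta>"
  have "ennreal c = ennreal (c / s) * emeasure lborel {s..2 * s}"
    using s by (simp add: ennreal_mult[symmetric] c_def)
  also have "\<dots> = (\<integral>\<^sup>+t. ennreal (c / s) * indicator {s..2 * s} t \<partial>lborel)"
    by (simp add: nn_integral_cmult_indicator)
  also have "\<dots> \<le> (\<integral>\<^sup>+t. ennreal (2 powr (1 + \<delta>) * (modulus h (max 0 t) / t) * (t * ?D) powr (- \<delta>)) *
      indicator {t. 0 < t \<and> t \<le> 1 \<and> dist x y \<le> t * ?D} t \<partial>lborel)"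
  proof (rule nn_integral_mono)
    fix t :: real
    show "ennreal (c / s) * indicator {s..2 * s} t \<le>
      ennreal (2 powr (1 + \<delta>) * (modulus h (max 0 t) / t) * (t * ?D) powr (- \<delta>)) *
      indicator {t. 0 < t \<and> t \<le> 1 \<and> dist x y \<le> t * ?D} t"
    proof (cases "t \<in> {s..2 * s}")
      case True
      then have t: "0 < t" "t \<le> 1" "s \<le> t" "t \<le> 2 * s" using s by auto
      have dt: "dist x y \<le> t * ?D" "t * ?D \<le> 2 * dist x y"
        using mult_right_mono[OF t(3) less_imp_le[OF D]] mult_right_mono[OF t(4) less_imp_le[OF D]] sD by auto
      have "c / s = 2 powr (1 + \<delta>) * (\<bar>h x - h y\<bar> / (2 * s)) * (2 * dist x y) powr (- \<delta>)"
        using s near by (simp add: c_def powr_add powr_mult powr_minus field_simps)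
      also have "\<dots> \<le> 2 powr (1 + \<delta>) * (modulus h t / t) * (t * ?D) powr (- \<delta>)"
      proof (rule mult_mono)
        have mod: "\<bar>h x - h y\<bar> \<le> modulus h t" by (rule diff_le_modulus[OF h dt(1)])
        then have "\<bar>h x - h y\<bar> / (2 * s) \<le> modulus h t / t"
          using t by (intro frac_le) auto
        then show "2 powr (1 + \<delta>) * (\<bar>h x - h y\<bar> / (2 * s)) \<le> 2 powr (1 + \<delta>) * (modulus h t / t)"
          by (rule mult_left_mono) simp
        show "(2 * dist x y) powr (- \<delta>) \<le> (t * ?D) powr (- \<delta>)"
          using t D dt delta_pos by (intro powr_mono2') auto
        show "0 \<le> 2 powr (1 + \<delta>) * (modulus h t / t)" using mod t by simp
      qed simp
      finally show ?thesis using True t dt by (simp add: ennreal_leI max_def)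
    qed simp
  qed
  finally show ?thesis by (simp add: c_def)
qed

text \<open>
  The heart of the matter. For points \<open>y\<close> near \<open>x\<close> the quotient is replaced by the integral over
  \<open>t\<close> from \<open>near_kernel_le\<close>. Exchanging the integrations, the inner integral over \<open>y\<close> becomes the
  measure of the ball of radius \<open>t * diameter UNIV\<close>, whose upper regularity cancels the factor
  \<open>(t * diameter UNIV) powr (- \<delta>)\<close> exactly; what remains is \<open>modulus h t / t\<close>, that is, the Dini
  integral. For points more than half the diameter away the kernel is bounded, and the supremum norm
  suffices.
\<close>

lemma dini_kernel_bound:
  "\<exists>K\<ge>0. \<forall>h\<in>dini_space. \<forall>x.
    (\<integral>\<^sup>+y. ennreal (\<bar>h x - h y\<bar> / dist x y powr \<delta>) \<partial>M) \<le> ennreal (K * dini_norm h)"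
proof (cases "diameter (UNIV :: 'a set) > 0")
  case False
  have one_point: "x = y" for x y :: 'a
    using order_trans[OF dist_le_diam[of x y], of 0] False by simp
  then have zero: "h x - h y = 0" for h :: "'a \<Rightarrow> real" and x y using arg_cong[OF one_point[of x y], of h] by simp
  show ?thesis by (rule exI[of _ 0]) (simp add: zero)
next
  case D: True
  let ?D = "diameter (UNIV :: 'a set)"
  obtain C where C: "C \<ge> 0" "\<And>(x::'a) r. 0 \<le> r \<Longrightarrow> measure M (cball x r) \<le> C * r powr \<delta>"
    using ball_measure_le[OF D] by blast
  define A where "A = 2 * measure M (space M) / (?D / 2) powr \<delta>"
  define B where "B = 2 powr (1 + \<delta>) * C"
  have AB: "A \<ge> 0" "B \<ge> 0" using C(1) by (simp_all add: A_def B_def)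
  have "(\<integral>\<^sup>+y. ennreal (\<bar>h x - h y\<bar> / dist x y powr \<delta>) \<partial>M) \<le> ennreal (max A B * dini_norm h)"
    if h: "h \<in> dini_space" for h and x :: 'a
  proof -
    define S where "S = (SUP x. \<bar>h x\<bar>)"
    define W where
      "W t = 2 powr (1 + \<delta>) * (modulus h (max 0 t) / t) * (t * ?D) powr (- \<delta>)" for t
    define I where "I y t = (ennreal (W t) *
        indicator {t. 0 < t \<and> t \<le> 1 \<and> dist x y \<le> t * ?D} t :: ennreal)" for y t
    have hS: "\<bar>h z\<bar> \<le> S" for z unfolding S_def by (rule dini_space_le_sup[OF h])
    have S0: "0 \<le> S" unfolding S_def by (rule dini_norm_ge[OF h])
    note [measurable] = modulus_measurable[OF h] dini_space_measurable[OF h]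
    have [measurable]: "W \<in> borel_measurable borel" unfolding W_def by measurable
    have I_meas: "case_prod I \<in> borel_measurable (M \<Otimes>\<^sub>M lborel)"
      unfolding I_def case_prod_beta indicator_def mem_Collect_eq by measurable
    have split: "ennreal (\<bar>h x - h y\<bar> / dist x y powr \<delta>) \<le>
        ennreal (2 * S / (?D / 2) powr \<delta>) + (\<integral>\<^sup>+t. I y t \<partial>lborel)" for y
    proof -
      consider "dist x y = 0" | "0 < dist x y" "dist x y \<le> ?D / 2" | "dist x y > ?D / 2"
        using zero_le_dist[of x y] by linarith
      then show ?thesis
      proof cases
        case 2
        then show ?thesis
          using near_kernel_le[OF h 2] unfolding I_def W_def by (simp add: add_increasing)
      next
        case 3
        have "\<bar>h x - h y\<bar> / dist x y powr \<delta> \<le> 2 * S / (?D / 2) powr \<delta>"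
        proof (rule frac_le)
          show "\<bar>h x - h y\<bar> \<le> 2 * S" using hS[of x] hS[of y] by linarith
          show "(?D / 2) powr \<delta> \<le> dist x y powr \<delta>"
            using 3 D delta_pos by (intro powr_mono2) auto
        qed (use D S0 in auto)
        then show ?thesis by (simp add: add_increasing2 ennreal_leI)
      qed simp
    qed
    have slice: "(\<integral>\<^sup>+y. I y t \<partial>M) \<le> ennreal B * (ennreal (modulus h t / t) * indicator {0<..1} t)" for t
    proof (cases "t \<in> {0<..1}")
      case True
      then have t: "0 < t" by simp
      have mod0: "0 \<le> modulus h t"
        using diff_le_modulus[OF h, of undefined undefined t] t D by simp
      have W0: "0 \<le> W t" using t mod0 by (simp add: W_def)
      have "(\<integral>\<^sup>+y. I y t \<partial>M) = (\<integral>\<^sup>+y. ennreal (W t) * indicator (cball x (t * ?D)) y \<partial>M)"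
        using True by (intro nn_integral_cong) (auto simp: I_def indicator_def)
      also have "\<dots> = ennreal (W t) * emeasure M (cball x (t * ?D))"
        by (rule nn_integral_cmult_indicator) (simp add: sets_M)
      also have "\<dots> = ennreal (W t * measure M (cball x (t * ?D)))"
        using W0 by (simp add: emeasure_eq_measure ennreal_mult)
      also have "\<dots> \<le> ennreal (W t * (C * (t * ?D) powr \<delta>))"
        using t D W0 by (intro ennreal_leI mult_left_mono C(2)) auto
      also have "W t * (C * (t * ?D) powr \<delta>) = B * (modulus h t / t)"
        using t D by (simp add: W_def B_def powr_minus max_def)
      also have "ennreal \<dots> = ennreal B * (ennreal (modulus h t / t) * indicator {0<..1} t)"
        using True AB t mod0 by (simp add: ennreal_mult[symmetric])
      finally show ?thesis .
    qed (auto simp: I_def indicator_def)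
    have fin: "dini_integral h < \<infinity>" using h by (simp add: dini_space_def)
    have swap: "pair_sigma_finite M (lborel :: real measure)"
      by (intro pair_sigma_finite.intro sigma_finite_lborel) unfold_locales
    have slice_meas: "(\<lambda>t. ennreal (modulus h t / t) * indicator {0<..1} t) \<in> borel_measurable borel"
    proof -
      have "(\<lambda>t. ennreal (modulus h t / t) * indicator {0<..1} t) =
          (\<lambda>t. ennreal (modulus h (max 0 t) / t) * indicator {0<..1} t)"
        by (auto simp: fun_eq_iff indicator_def max_def)
      then show ?thesis by simp
    qed
    have "(\<integral>\<^sup>+y. \<integral>\<^sup>+t. I y t \<partial>lborel \<partial>M) = (\<integral>\<^sup>+t. \<integral>\<^sup>+y. I y t \<partial>M \<partial>lborel)"
      by (rule pair_sigma_finite.Fubini'[OF swap I_meas, symmetric])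
    also have "\<dots> \<le> (\<integral>\<^sup>+t. ennreal B * (ennreal (modulus h t / t) * indicator {0<..1} t) \<partial>lborel)"
      by (intro nn_integral_mono slice)
    also have "\<dots> = ennreal B * dini_integral h"
      unfolding dini_integral_def by (rule nn_integral_cmult) (use slice_meas in simp)
    also have "\<dots> = ennreal (B * enn2real (dini_integral h))"
      using AB fin by (simp add: ennreal_mult)
    finally have near: "(\<integral>\<^sup>+y. \<integral>\<^sup>+t. I y t \<partial>lborel \<partial>M) \<le> ennreal (B * enn2real (dini_integral h))" .
    have far: "ennreal (2 * S / (?D / 2) powr \<delta>) * emeasure M (space M) = ennreal (A * S)"
      using S0 by (simp add: A_def emeasure_eq_measure ennreal_mult[symmetric] mult_ac)
    have "(\<integral>\<^sup>+y. ennreal (\<bar>h x - h y\<bar> / dist x y powr \<delta>) \<partial>M) \<le>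
        (\<integral>\<^sup>+y. ennreal (2 * S / (?D / 2) powr \<delta>) + (\<integral>\<^sup>+t. I y t \<partial>lborel) \<partial>M)"
      by (intro nn_integral_mono split)
    also have "\<dots> = ennreal (A * S) + (\<integral>\<^sup>+y. \<integral>\<^sup>+t. I y t \<partial>lborel \<partial>M)"
    proof (subst nn_integral_add)
      show "(\<lambda>y. \<integral>\<^sup>+t. I y t \<partial>lborel) \<in> borel_measurable M"
        using lborel.borel_measurable_nn_integral[OF I_meas] .
    qed (simp_all add: far)
    also have "\<dots> \<le> ennreal (A * S) + ennreal (B * enn2real (dini_integral h))"
      by (intro add_left_mono near)
    also have "\<dots> = ennreal (A * S + B * enn2real (dini_integral h))"
      using AB S0 by (simp add: ennreal_plus)
    also have "\<dots> \<le> ennreal (max A B * dini_norm h)"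
    proof (rule ennreal_leI)
      have "A * S \<le> max A B * S" "B * enn2real (dini_integral h) \<le> max A B * enn2real (dini_integral h)"
        using S0 by (auto intro!: mult_right_mono)
      then show "A * S + B * enn2real (dini_integral h) \<le> max A B * dini_norm h"
        by (simp add: dini_norm_def S_def ring_distribs)
    qed
    finally show ?thesis .
  qed
  then show ?thesis using AB by (intro exI[of _ "max A B"]) auto
qed

end

section \<open>The Laplacian of a Dini function\<close>

context ahlfors_form_space begin

lemma lipschitz_in_dini_space:
  assumes lip: "L-lipschitz_on UNIV (g :: 'a \<Rightarrow> real)" and bdd: "bounded (range g)"
  shows "g \<in> dini_space"
proof -
  define D where "D = diameter (UNIV :: 'a set)"
  have D0: "0 \<le> D" using dist_le_diam[of undefined undefined] by (simp add: D_def)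
  have L0: "0 \<le> L" using lip by (simp add: lipschitz_on_def)
  have mod: "modulus g t \<le> L * (t * D)" if "0 \<le> t" for t
    unfolding modulus_def D_def[symmetric]
  proof (rule cSup_least)
    have "0 \<le> t * D" using that D0 by simp
    then show "{\<bar>g x - g y\<bar> | x y. dist x y \<le> t * D} \<noteq> {}"
      by (auto intro!: exI[of _ undefined])
    fix v assume "v \<in> {\<bar>g x - g y\<bar> | x y. dist x y \<le> t * D}"
    then obtain x y where v: "v = \<bar>g x - g y\<bar>" "dist x y \<le> t * D" by blast
    have "v \<le> L * dist x y" using lipschitz_onD[OF lip, of x y] v(1) by (simp add: dist_real_def)
    also have "\<dots> \<le> L * (t * D)" using v(2) L0 by (rule mult_left_mono)
    finally show "v \<le> L * (t * D)" .
  qed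
  have "dini_integral g \<le> (\<integral>\<^sup>+t. ennreal (L * D) * indicator {0<..1::real} t \<partial>lborel)"
    unfolding dini_integral_def
  proof (rule nn_integral_mono)
    fix t :: real
    show "ennreal (modulus g t / t) * indicator {0<..1} t \<le> ennreal (L * D) * indicator {0<..1} t"
      using mod[of t] by (auto simp: indicator_def field_simps intro!: ennreal_leI)
  qed
  also have "\<dots> < \<infinity>"
    by (subst nn_integral_cmult_indicator) (auto simp: ennreal_mult_less_top)
  finally show ?thesis
    using lipschitz_on_uniformly_continuous[OF lip] bdd by (simp add: dini_space_def)
qed

lemma bounded_in_square_integrable:
  fixes f :: "'a \<Rightarrow> real"
  assumes "f \<in> borel_measurable M" "\<And>x. \<bar>f x\<bar> \<le> b"
  shows "f \<in> square_integrable M"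
proof -
  have "integrable M (\<lambda>x. (f x)\<^sup>2)"
  proof (rule integrable_const_bound)
    show "AE x in M. norm ((f x)\<^sup>2) \<le> b\<^sup>2"
      using power_mono[OF assms(2) abs_ge_zero, where n = 2] by simp
  qed (use assms(1) in simp)
  then show ?thesis using assms(1) by (simp add: square_integrable_def)
qed

lemma dini_square_integrable: "h \<in> dini_space \<Longrightarrow> h \<in> square_integrable M"
  by (rule bounded_in_square_integrable[OF dini_space_measurable dini_space_le_sup])

text \<open>
  One of the two factors \<open>\<bar>h x - h y\<bar>\<close> is bounded by \<open>2 * S\<close>, and \<open>dini_kernel_bound\<close> integrates the
  other one against the kernel.
\<close>

lemma dini_in_energy_space:
  assumes h: "h \<in> dini_space"
  shows "h \<in> energy_space M \<delta>"
proof (rule square_integrable_imp_energy_space[OF dini_square_integrable[OF h]])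
  obtain K where K: "K \<ge> 0"
      "\<And>x. (\<integral>\<^sup>+y. ennreal (\<bar>h x - h y\<bar> / dist x y powr \<delta>) \<partial>M) \<le> ennreal (K * dini_norm h)"
    using dini_kernel_bound h by blast
  define S where "S = (SUP x. \<bar>h x\<bar>)"
  have S: "\<bar>h x\<bar> \<le> S" "0 \<le> S" for x
    unfolding S_def by (rule dini_space_le_sup[OF h], rule dini_norm_ge(2)[OF h])
  note [measurable] = dini_space_measurable[OF h]
  have "(\<integral>\<^sup>+y. ennreal (\<bar>h x - h y\<bar>\<^sup>2 / dist x y powr \<delta>) \<partial>M) \<le>
      ennreal (2 * S) * ennreal (K * dini_norm h)" for x
  proof -
    have "(\<integral>\<^sup>+y. ennreal (\<bar>h x - h y\<bar>\<^sup>2 / dist x y powr \<delta>) \<partial>M) \<le>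
        (\<integral>\<^sup>+y. ennreal (2 * S) * ennreal (\<bar>h x - h y\<bar> / dist x y powr \<delta>) \<partial>M)"
    proof (rule nn_integral_mono)
      fix y
      have "\<bar>h x - h y\<bar> \<le> 2 * S" using S(1)[of x] S(1)[of y] by linarith
      then have "\<bar>h x - h y\<bar> * (\<bar>h x - h y\<bar> / dist x y powr \<delta>) \<le>
          2 * S * (\<bar>h x - h y\<bar> / dist x y powr \<delta>)"
        by (rule mult_right_mono) simp
      then show "ennreal (\<bar>h x - h y\<bar>\<^sup>2 / dist x y powr \<delta>) \<le>
          ennreal (2 * S) * ennreal (\<bar>h x - h y\<bar> / dist x y powr \<delta>)"
        using S(2) by (simp add: ennreal_mult[symmetric] power2_eq_square ennreal_leI)
    qed
    also have "\<dots> = ennreal (2 * S) * (\<integral>\<^sup>+y. ennreal (\<bar>h x - h y\<bar> / dist x y powr \<delta>) \<partial>M)"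
      by (rule nn_integral_cmult) simp
    also have "\<dots> \<le> ennreal (2 * S) * ennreal (K * dini_norm h)"
      by (intro mult_left_mono K(2)) simp
    finally show ?thesis .
  qed
  then have "(\<integral>\<^sup>+x. \<integral>\<^sup>+y. ennreal (\<bar>h x - h y\<bar>\<^sup>2 / dist x y powr \<delta>) \<partial>M \<partial>M) \<le>
      (\<integral>\<^sup>+x. ennreal (2 * S) * ennreal (K * dini_norm h) \<partial>M)"
    by (rule nn_integral_mono)
  also have "\<dots> < \<infinity>"
    by (simp add: ennreal_mult_less_top emeasure_eq_measure)
  finally show "(\<integral>\<^sup>+x. \<integral>\<^sup>+y. ennreal (\<bar>h x - h y\<bar>\<^sup>2 / dist x y powr \<delta>) \<partial>M \<partial>M) < \<infinity>" .
qed

text \<open>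
  The form is densely defined: the bounded Lipschitz functions are Dini continuous, hence of finite
  energy, and they separate.
\<close>

lemma energy_space_separating:
  assumes \<phi>: "\<phi> \<in> square_integrable M"
    and zero: "\<And>g. g \<in> energy_space M \<delta> \<Longrightarrow> (LINT x|M. \<phi> x * g x) = 0"
  shows "AE x in M. \<phi> x = 0"
proof (rule lipschitz_separating)
  have "(\<lambda>_. 1) \<in> square_integrable M" by (simp add: square_integrable_def)
  from square_integrable_mult[OF \<phi> this] show "integrable M \<phi>" by simp
qed (use zero dini_in_energy_space lipschitz_in_dini_space in blast)

text \<open>
  The operator is described through some right-hand side with the given resolvent, so its value is
  determined only if the resolvent is injective. Two right-hand sides with the same weak solution
  have the same integrals against the energy space, and this space separates.
\<close>

lemma log_laplacian_l2_class:
  assumes f: "f \<in> square_integrable M" and u: "weak_solution f u"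
  shows "log_laplacian M \<delta> (l2_class M u) = l2_class M (\<lambda>x. f x - u x)"
proof -
  have usq: "u \<in> square_integrable M" using u by (simp add: weak_solution_def energy_space_def)
  have R: "log_resolvent M \<delta> (l2_class M f) = l2_class M u" by (rule log_resolvent_l2_class[OF f u])
  show ?thesis
    unfolding log_laplacian_def
  proof (rule the_equality)
    show "\<exists>F\<in>L2 M. l2_class M u = log_resolvent M \<delta> F \<and>
        l2_class M (\<lambda>x. f x - u x) = l2_diff M F (log_resolvent M \<delta> F)"
      using R f l2_class_in_L2[OF f] l2_diff_l2_class[OF f usq] by (intro bexI[of _ "l2_class M f"]) auto
  next
    fix V assume "\<exists>F\<in>L2 M. l2_class M u = log_resolvent M \<delta> F \<and> V = l2_diff M F (log_resolvent M \<delta> F)"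
    then obtain f' where f': "f' \<in> square_integrable M"
        "l2_class M u = log_resolvent M \<delta> (l2_class M f')"
        "V = l2_diff M (l2_class M f') (log_resolvent M \<delta> (l2_class M f'))"
      by (auto simp: L2_def)
    obtain u' where u': "weak_solution f' u'" using weak_solution_exists[OF f'(1)] by blast
    have u'sq: "u' \<in> square_integrable M" using u' by (simp add: weak_solution_def energy_space_def)
    have "l2_class M u = l2_class M u'" using f'(2) log_resolvent_l2_class[OF f'(1) u'] by simp
    then have ae: "AE x in M. u x = u' x" using l2_class_eq_iff[OF usq u'sq] by simp
    have "AE x in M. f x - f' x = 0"
    proof (rule energy_space_separating[OF square_integrable_diff[OF f f'(1)]])
      fix g assume g: "g \<in> energy_space M \<delta>"
      have gsq: "g \<in> square_integrable M" using g by (simp add: energy_space_def)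
      have "energy_inner M \<delta> u g = energy_inner M \<delta> u' g"
        by (rule energy_inner_cong_AE) (use u u' g ae in \<open>auto simp: weak_solution_def\<close>)
      then have "(LINT x|M. f x * g x) = (LINT x|M. f' x * g x)"
        using u u' g by (simp add: weak_solution_def)
      then show "(LINT x|M. (f x - f' x) * g x) = 0"
        using square_integrable_mult[OF f gsq] square_integrable_mult[OF f'(1) gsq]
        by (simp add: left_diff_distrib)
    qed
    then have "l2_class M f' = l2_class M f"
      using l2_class_eq_iff[OF f'(1) f] by (auto elim: AE_mp)
    then show "V = l2_class M (\<lambda>x. f x - u x)"
      using f'(3) R l2_diff_l2_class[OF f usq] by simp
  qed
qed

definition pointwise_laplacian :: "('a \<Rightarrow> real) \<Rightarrow> 'a \<Rightarrow> real" where
  "pointwise_laplacian h x = (LINT y|M. (h x - h y) / dist x y powr \<delta>)"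

lemma kernel_measurable:
  assumes [measurable]: "h \<in> borel_measurable M"
  shows "(\<lambda>(x, y). (h x - h y) / dist x y powr \<delta>) \<in> borel_measurable (M \<Otimes>\<^sub>M M)"
  unfolding case_prod_beta by measurable

lemma pointwise_laplacian_measurable:
  assumes "h \<in> dini_space"
  shows "pointwise_laplacian h \<in> borel_measurable M"
  unfolding pointwise_laplacian_def
  by (rule borel_measurable_lebesgue_integral[OF kernel_measurable[OF dini_space_measurable[OF assms]]])

lemma pointwise_laplacian_bound:
  "\<exists>K\<ge>0. \<forall>h\<in>dini_space. \<forall>x. \<bar>pointwise_laplacian h x\<bar> \<le> K * dini_norm h"
proof -
  obtain K where K: "K \<ge> 0" "\<And>h x. h \<in> dini_space \<Longrightarrow>
      (\<integral>\<^sup>+y. ennreal (\<bar>h x - h y\<bar> / dist x y powr \<delta>) \<partial>M) \<le> ennreal (K * dini_norm h)"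
    using dini_kernel_bound by blast
  have "\<bar>pointwise_laplacian h x\<bar> \<le> K * dini_norm h" if h: "h \<in> dini_space" for h x
  proof -
    note [measurable] = dini_space_measurable[OF h]
    have nn: "(\<integral>\<^sup>+y. ennreal (norm ((h x - h y) / dist x y powr \<delta>)) \<partial>M) \<le> ennreal (K * dini_norm h)"
      using K(2)[OF h] by (simp add: abs_divide)
    then have "integrable M (\<lambda>y. (h x - h y) / dist x y powr \<delta>)"
      by (intro integrableI_bounded) (auto simp: order_le_less_trans)
    from order_trans[OF integral_norm_bound_ennreal[OF this] nn] show ?thesis
      using K(1) dini_norm_ge(3)[OF h] by (simp add: pointwise_laplacian_def)
  qed
  then show ?thesis using K(1) by blast
qed

lemma pointwise_laplacian_square_integrable:
  assumes "h \<in> dini_space"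
  shows "pointwise_laplacian h \<in> square_integrable M"
proof -
  obtain K where "\<And>x. \<bar>pointwise_laplacian h x\<bar> \<le> K * dini_norm h"
    using pointwise_laplacian_bound assms by blast
  then show ?thesis
    by (rule bounded_in_square_integrable[OF pointwise_laplacian_measurable[OF assms]])
qed

text \<open>
  Green's formula. The product \<open>(h x - h y) * (g x - g y)\<close> splits into two terms that are exchanged
  by swapping \<open>x\<close> and \<open>y\<close>. The kernel bound makes each of them absolutely integrable, although
  \<open>g\<close> is merely square-integrable, and integrating out \<open>y\<close> gives the pointwise Laplacian.
\<close>

lemma energy_inner_dini:
  assumes h: "h \<in> dini_space" and g: "g \<in> energy_space M \<delta>"
  shows "energy_inner M \<delta> h g = (LINT x|M. (h x + pointwise_laplacian h x) * g x)"
proof -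
  obtain K where K: "K \<ge> 0"
      "\<And>x. (\<integral>\<^sup>+y. ennreal (\<bar>h x - h y\<bar> / dist x y powr \<delta>) \<partial>M) \<le> ennreal (K * dini_norm h)"
    using dini_kernel_bound h by blast
  have gsq: "g \<in> square_integrable M" using g by (simp add: energy_space_def)
  have g1: "integrable M g"
    using square_integrable_mult[OF gsq bounded_in_square_integrable[of "\<lambda>_. 1" 1]] by simp
  note [measurable] = dini_space_measurable[OF h] borel_measurable_integrable[OF g1]
  define P where "P = (\<lambda>(x, y). (h x - h y) / dist x y powr \<delta> * g x)"
  have [measurable]: "P \<in> borel_measurable (M \<Otimes>\<^sub>M M)" unfolding P_def case_prod_beta by measurable
  have P: "integrable (M \<Otimes>\<^sub>M M) P"
  proof (rule integrableI_bounded)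
    have "(\<integral>\<^sup>+z. ennreal (norm (P z)) \<partial>(M \<Otimes>\<^sub>M M)) = (\<integral>\<^sup>+x. \<integral>\<^sup>+y. ennreal (norm (P (x, y))) \<partial>M \<partial>M)"
      by (rule nn_integral_fst[symmetric]) simp
    also have "\<dots> \<le> (\<integral>\<^sup>+x. ennreal (K * dini_norm h) * ennreal \<bar>g x\<bar> \<partial>M)"
    proof (rule nn_integral_mono)
      fix x
      have "(\<integral>\<^sup>+y. ennreal (norm (P (x, y))) \<partial>M) =
          (\<integral>\<^sup>+y. ennreal (\<bar>h x - h y\<bar> / dist x y powr \<delta>) * ennreal \<bar>g x\<bar> \<partial>M)"
        by (intro nn_integral_cong) (simp add: P_def abs_mult abs_divide ennreal_mult[symmetric])
      also have "\<dots> = (\<integral>\<^sup>+y. ennreal (\<bar>h x - h y\<bar> / dist x y powr \<delta>) \<partial>M) * ennreal \<bar>g x\<bar>"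
        by (rule nn_integral_multc) simp
      also have "\<dots> \<le> ennreal (K * dini_norm h) * ennreal \<bar>g x\<bar>"
        by (intro mult_right_mono K(2)) simp
      finally show "(\<integral>\<^sup>+y. ennreal (norm (P (x, y))) \<partial>M) \<le> ennreal (K * dini_norm h) * ennreal \<bar>g x\<bar>" .
    qed
    also have "\<dots> = ennreal (K * dini_norm h) * (\<integral>\<^sup>+x. ennreal \<bar>g x\<bar> \<partial>M)"
      by (rule nn_integral_cmult) simp
    also have "\<dots> < \<infinity>"
      using g1 by (simp add: integrable_iff_bounded ennreal_mult_less_top)
    finally show "(\<integral>\<^sup>+z. ennreal (norm (P z)) \<partial>(M \<Otimes>\<^sub>M M)) < \<infinity>" .
  qed simp
  have swapped: "integrable (M \<Otimes>\<^sub>M M) (\<lambda>(x, y). P (y, x))"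
    by (rule pair.integrable_product_swap[OF P])
  have "(LINT z|(M \<Otimes>\<^sub>M M). diff_quot \<delta> h z * diff_quot \<delta> g z) =
      (LINT z|(M \<Otimes>\<^sub>M M). P z + (case z of (x, y) \<Rightarrow> P (y, x)))"
  proof (rule Bochner_Integration.integral_cong[OF refl])
    fix z :: "'a \<times> 'a"
    obtain x y where "z = (x, y)" by (cases z)
    then show "diff_quot \<delta> h z * diff_quot \<delta> g z = P z + (case z of (x, y) \<Rightarrow> P (y, x))"
      by (simp add: diff_quot_mult P_def dist_commute[of y x] add_divide_distrib[symmetric])
        (simp add: algebra_simps)
  qed
  also have "\<dots> = (LINT z|(M \<Otimes>\<^sub>M M). P z) + (LINT (x, y)|(M \<Otimes>\<^sub>M M). P (y, x))"
    by (rule Bochner_Integration.integral_add[OF P swapped])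
  also have "\<dots> = 2 * (LINT z|(M \<Otimes>\<^sub>M M). P z)"
    using pair.integral_product_swap[of P] by simp
  also have "(LINT z|(M \<Otimes>\<^sub>M M). P z) = (LINT x|M. LINT y|M. P (x, y))"
    by (rule pair.integral_fst'[OF P, symmetric])
  also have "\<dots> = (LINT x|M. pointwise_laplacian h x * g x)"
    by (simp add: P_def pointwise_laplacian_def del: times_divide_eq_left)
  finally show ?thesis
    using square_integrable_mult[OF pointwise_laplacian_square_integrable[OF h] gsq]
      square_integrable_mult[OF dini_square_integrable[OF h] gsq]
    by (simp add: energy_inner_def distrib_right)
qed

text \<open>
  By Green's formula \<open>h\<close> is the weak solution with right-hand side \<open>h + pointwise_laplacian h\<close>.
\<close>

lemma dini_laplacian:
  assumes h: "h \<in> dini_space"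
  shows "l2_class M h \<in> dom_log_laplacian M \<delta>"
    "log_laplacian M \<delta> (l2_class M h) = l2_class M (pointwise_laplacian h)"
proof -
  let ?f = "\<lambda>x. h x + pointwise_laplacian h x"
  have f: "?f \<in> square_integrable M"
    using square_integrable_lincomb[OF dini_square_integrable[OF h]
        pointwise_laplacian_square_integrable[OF h], of 1] by simp
  have u: "weak_solution ?f h"
    using dini_in_energy_space[OF h] energy_inner_dini[OF h] by (simp add: weak_solution_def)
  show "l2_class M h \<in> dom_log_laplacian M \<delta>"
    unfolding dom_log_laplacian_def
    using log_resolvent_l2_class[OF f u] l2_class_in_L2[OF f] by (metis imageI)
  show "log_laplacian M \<delta> (l2_class M h) = l2_class M (pointwise_laplacian h)"
    using log_laplacian_l2_class[OF f u] by simp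
qed

lemma dini_graph_norm_bound:
  "\<exists>K. \<forall>h\<in>dini_space. graph_norm M \<delta> (l2_class M h) \<le> K * dini_norm h"
proof -
  obtain K where K: "\<And>h x. h \<in> dini_space \<Longrightarrow> \<bar>pointwise_laplacian h x\<bar> \<le> K * dini_norm h" "K \<ge> 0"
    using pointwise_laplacian_bound by blast
  define c where "c = sqrt (measure M (space M))"
  have "graph_norm M \<delta> (l2_class M h) \<le> c * (1 + K) * dini_norm h" if h: "h \<in> dini_space" for h
  proof -
    note norm_le = l2_norm_l2_class_le[OF finite_measure_axioms]
    have "l2_norm M (l2_class M h) \<le> c * dini_norm h"
      unfolding c_def
      by (rule norm_le[OF dini_square_integrable[OF h] dini_norm_ge(3)[OF h]
            order_trans[OF dini_space_le_sup[OF h] dini_norm_ge(1)[OF h]]])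
    moreover have "l2_norm M (l2_class M (pointwise_laplacian h)) \<le> c * (K * dini_norm h)"
      unfolding c_def
      by (rule norm_le[OF pointwise_laplacian_square_integrable[OF h] _ K(1)[OF h]])
        (use K(2) dini_norm_ge(3)[OF h] in simp)
    ultimately show ?thesis
      by (simp add: graph_norm_def dini_laplacian(2)[OF h] algebra_simps)
  qed
  then show ?thesis by blast
qed

text \<open>
  Balls of positive radius have positive measure, so continuous functions that agree almost
  everywhere agree.
\<close>

lemma l2_class_inj_on_dini:
  assumes "emeasure M UNIV \<noteq> 0"
  shows "inj_on (l2_class M) dini_space"
proof (rule inj_onI)
  fix h k assume h: "h \<in> dini_space" and k: "k \<in> dini_space" and eq: "l2_class M h = l2_class M k"
  then have ae: "AE x in M. h x = k x"
    using l2_class_eq_iff dini_square_integrable by blast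
  show "h = k"
  proof (rule ccontr)
    assume "h \<noteq> k"
    then obtain a where a: "h a \<noteq> k a" by blast
    have "continuous_on UNIV h" "continuous_on UNIV k"
      using h k by (auto simp: dini_space_def intro: uniformly_continuous_imp_continuous)
    then have "open {x. h x \<noteq> k x}"
      by (intro open_Collect_neq)
    then obtain r where r: "r > 0" "cball a r \<subseteq> {x. h x \<noteq> k x}"
      using a by (auto simp: open_contains_cball)
    have "AE x in M. x \<notin> cball a r" using ae by eventually_elim (use r(2) in auto)
    then have "emeasure M (cball a r) = 0"
      by (subst (asm) AE_iff_null_sets[symmetric]) (auto simp: sets_M)
    then show False using ball_measure_pos[OF assms r(1), of a] by (simp add: measure_def)
  qed
qed

end

theorem corollary4p10:
  fixes M :: "'a::{metric_space,second_countable_topology} measure" and \<delta> :: real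
  assumes "\<delta> > 0"
    and "metric_measure_space M"
    and "ahlfors_regular M \<delta>"
  shows "l2_class M ` dini_space \<subseteq> dom_log_laplacian M \<delta> \<and>
    (emeasure M UNIV \<noteq> 0 \<longrightarrow> inj_on (l2_class M) dini_space) \<and>
    (\<exists>K. \<forall>h\<in>dini_space. graph_norm M \<delta> (l2_class M h) \<le> K * dini_norm h)"
proof -
  interpret ahlfors_form_space M \<delta>
    by (intro ahlfors_form_space.intro borel_form_space.intro borel_form_space_axioms.intro
        ahlfors_form_space_axioms.intro)
      (use assms in \<open>auto simp: metric_measure_space_def\<close>)
  show ?thesis
    using dini_laplacian(1) l2_class_inj_on_dini dini_graph_norm_bound by blast
qed

end
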